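(* Let $d\ge2$. For every $d$-dimensional simplex $S$ in $\mathbb{H}^d$, $\tanh\mathrm{cirr}(S)\ge d\tanh\mathrm{ir}(S)$, with equality if and only if $S$ is regular. Furthermore, for $d\in\{2,3\}$ and every $d$-dimensional simplex $S$ in $\mathbb{S}^d$, $\tan\mathrm{cirr}(S)\ge d\tan\mathrm{ir}(S)$, with equality if and only if $S$ is regular.
   Context: $\mathrm{ir}(S)$ (inradius) is the radius of a largest ball contained in $S$ and $\mathrm{cirr}(S)$ (circumradius) is the radius of a smallest ball containing $S$. A spherical simplex is the spherical convex hull of $d+1$ points in an open hemisphere of $\mathbb{S}^d$ not on a common great subsphere. A regular simplex has all edges of equal length. *)

theory Defs
  imports Complex_Main
begin

text \<open>Points of the ambient space R^(d+1) are functions nat => real vanishing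
  above index d (coordinates 0..d).  A simplex is given by its vertices v 0, ..., v d.\<close>

definition ambient :: "nat \<Rightarrow> (nat \<Rightarrow> real) set" where
  "ambient d = {x. \<forall>i>d. x i = 0}"

definition eucl :: "nat \<Rightarrow> (nat \<Rightarrow> real) \<Rightarrow> (nat \<Rightarrow> real) \<Rightarrow> real" where
  "eucl d x y = (\<Sum>i\<le>d. x i * y i)"

definition lor :: "nat \<Rightarrow> (nat \<Rightarrow> real) \<Rightarrow> (nat \<Rightarrow> real) \<Rightarrow> real" where
  "lor d x y = - x 0 * y 0 + (\<Sum>i\<in>{1..d}. x i * y i)"

definition hyp :: "nat \<Rightarrow> (nat \<Rightarrow> real) set" where
  "hyp d = {x \<in> ambient d. lor d x x = -1 \<and> x 0 > 0}"

definition hdist :: "nat \<Rightarrow> (nat \<Rightarrow> real) \<Rightarrow> (nat \<Rightarrow> real) \<Rightarrow> real" where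
  "hdist d x y = arcosh (- lor d x y)"

definition sph :: "nat \<Rightarrow> (nat \<Rightarrow> real) set" where
  "sph d = {x \<in> ambient d. eucl d x x = 1}"

definition sdist :: "nat \<Rightarrow> (nat \<Rightarrow> real) \<Rightarrow> (nat \<Rightarrow> real) \<Rightarrow> real" where
  "sdist d x y = arccos (eucl d x y)"

definition gconvex :: "'p set \<Rightarrow> ('p \<Rightarrow> 'p \<Rightarrow> real) \<Rightarrow> 'p set \<Rightarrow> bool" where
  "gconvex M \<delta> A \<longleftrightarrow> A \<subseteq> M \<and>
     (\<forall>x\<in>A. \<forall>y\<in>A. \<forall>z\<in>M. \<delta> x z + \<delta> z y = \<delta> x y \<longrightarrow> z \<in> A)"

definition ghull :: "'p set \<Rightarrow> ('p \<Rightarrow> 'p \<Rightarrow> real) \<Rightarrow> 'p set \<Rightarrow> 'p set" where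
  "ghull M \<delta> P = \<Inter>{A. gconvex M \<delta> A \<and> P \<subseteq> A}"

definition cball_in :: "'p set \<Rightarrow> ('p \<Rightarrow> 'p \<Rightarrow> real) \<Rightarrow> 'p \<Rightarrow> real \<Rightarrow> 'p set" where
  "cball_in M \<delta> c r = {x \<in> M. \<delta> c x \<le> r}"

definition inradius :: "'p set \<Rightarrow> ('p \<Rightarrow> 'p \<Rightarrow> real) \<Rightarrow> 'p set \<Rightarrow> real" where
  "inradius M \<delta> S = Sup {r. r \<ge> 0 \<and> (\<exists>c\<in>M. cball_in M \<delta> c r \<subseteq> S)}"

definition circumradius :: "'p set \<Rightarrow> ('p \<Rightarrow> 'p \<Rightarrow> real) \<Rightarrow> 'p set \<Rightarrow> real" where
  "circumradius M \<delta> S = Inf {r. r \<ge> 0 \<and> (\<exists>c\<in>M. S \<subseteq> cball_in M \<delta> c r)}"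

text \<open>v 0, ..., v d linearly independent in R^(d+1), i.e. not on a common
  (linear) hyperplane: for H^d in the hyperboloid model and for S^d these are exactly
  the totally geodesic hyperplanes / great subspheres.\<close>
definition lin_indep :: "nat \<Rightarrow> (nat \<Rightarrow> nat \<Rightarrow> real) \<Rightarrow> bool" where
  "lin_indep d v \<longleftrightarrow>
     (\<forall>c::nat \<Rightarrow> real. (\<forall>i\<le>d. (\<Sum>j\<le>d. c j * v j i) = 0) \<longrightarrow> (\<forall>j\<le>d. c j = 0))"

definition hyp_simplex_vertices :: "nat \<Rightarrow> (nat \<Rightarrow> nat \<Rightarrow> real) \<Rightarrow> bool" where
  "hyp_simplex_vertices d v \<longleftrightarrow> (\<forall>j\<le>d. v j \<in> hyp d) \<and> lin_indep d v"

definition sph_simplex_vertices :: "nat \<Rightarrow> (nat \<Rightarrow> nat \<Rightarrow> real) \<Rightarrow> bool" where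
  "sph_simplex_vertices d v \<longleftrightarrow> (\<forall>j\<le>d. v j \<in> sph d) \<and> lin_indep d v \<and>
     (\<exists>u\<in>ambient d. \<forall>j\<le>d. eucl d u (v j) > 0)"

definition regular_simplex :: "('p \<Rightarrow> 'p \<Rightarrow> real) \<Rightarrow> nat \<Rightarrow> (nat \<Rightarrow> 'p) \<Rightarrow> bool" where
  "regular_simplex \<delta> d v \<longleftrightarrow>
     (\<forall>i\<le>d. \<forall>j\<le>d. \<forall>k\<le>d. \<forall>l\<le>d. i \<noteq> j \<longrightarrow> k \<noteq> l \<longrightarrow> \<delta> (v i) (v j) = \<delta> (v k) (v l))"

end

theory Submission
  imports Defs "Jordan_Normal_Form.Determinant"
begin

text \<open>Let \<open>B\<close> be the ambient bilinear form, \<open>g 0, ..., g d\<close> the basis dual to the vertices,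
  and let \<open>x'\<close> denote the projection of \<open>x\<close> orthogonal to a point \<open>o\<close> of the space.  The products
  \<open>B (g j)' (v j)'\<close> add up to \<open>d\<close>, the trace of the identity of the tangent space at \<open>o\<close>.
  A ball inside the simplex bounds the lengths of the \<open>(g j)'\<close>, a ball around it those of the \<open>(v j)'\<close>,
  and the Cauchy-Schwarz inequality bounds the trace.  In the hyperbolic case \<open>o\<close> is the centre of
  the inner ball, and the outer ball is a subset of a Euclidean ball of radius \<open>tanh R\<close> in the Klein model;
  in the spherical case \<open>o\<close> is the centre of the outer ball.  Equality forces the two centres to
  coincide.\<close>

section \<open>Quadratic forms of the two model spaces\<close>

text \<open>The two centres differ in general and only one of them can be the origin
  \<open>o\<close>; this shapes both estimates. Seen from the inner centre, an off-centre hyperbolic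
  ball still fits into a Euclidean ball of radius \<open>tanh R\<close>, and translating that
  Euclidean ball costs nothing: the combination of the \<open>g j\<close> with coefficients
  \<open>e * B (v j) c\<close> is a multiple of \<open>c\<close>, so a common shift drops out of the
  trace. On the sphere, central projection from another point enlarges a cap beyond radius
  \<open>tan R\<close>. There the origin moves to the outer centre, and the estimate for the
  displaced inner ball loses a multiple of \<open>1 - B c p\<close>, which has the favourable sign.
  The hull is defined by metric betweenness and the radii as a supremum and an infimum. So the hull
  has to be recognised as a cone, and the equality case needs centres for the exact radii. For these
  only the inequalities expressing the ball conditions are passed to a limit, not the inclusions of
  sets. For a regular simplex one pair of admissible radii with equality is enough, since the
  inequality then leaves no room.\<close>

text \<open>The matrix with columns \<open>v j\<close> is nonsingular; \<open>H\<close> is its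
  inverse. One product gives duality, the other the expansion of an arbitrary vector in the
  vertices.\<close>

lemma lin_indep_inverse:
  assumes "lin_indep d v"
  obtains H :: "nat \<Rightarrow> nat \<Rightarrow> real" where
    "\<And>j k. j \<le> d \<Longrightarrow> k \<le> d \<Longrightarrow> (\<Sum>i\<le>d. H j i * v k i) = (if j = k then 1 else 0)"
    "\<And>i k. i \<le> d \<Longrightarrow> k \<le> d \<Longrightarrow> (\<Sum>j\<le>d. v j i * H j k) = (if i = k then 1 else 0)"
proof -
  define A where "A = mat (Suc d) (Suc d) (\<lambda>(i, j). v j i)"
  have A: "A \<in> carrier_mat (Suc d) (Suc d)" by (simp add: A_def)
  have "det A \<noteq> 0"
  proof
    assume "det A = 0"
    then obtain c where c: "c \<in> carrier_vec (Suc d)" "c \<noteq> 0\<^sub>v (Suc d)" "A *\<^sub>v c = 0\<^sub>v (Suc d)"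
      using det_0_iff_vec_prod_zero_field[OF A] by auto
    have "(\<Sum>j\<le>d. c $ j * v j i) = 0" if "i \<le> d" for i
    proof -
      have "(A *\<^sub>v c) $ i = 0" using c(3) that by simp
      then have "(\<Sum>j<Suc d. v j i * c $ j) = 0"
        using that c(1) by (simp add: A_def scalar_prod_def atLeast0LessThan)
      then show ?thesis by (simp add: lessThan_Suc_atMost mult.commute)
    qed
    then have "\<forall>j\<le>d. c $ j = 0" using assms unfolding lin_indep_def by blast
    then have "c = 0\<^sub>v (Suc d)" using c(1) by (intro eq_vecI) auto
    with c(2) show False by simp
  qed
  then obtain B where B: "B \<in> carrier_mat (Suc d) (Suc d)" "B * A = 1\<^sub>m (Suc d)" "A * B = 1\<^sub>m (Suc d)"
    using det_non_zero_imp_unit[OF A] unfolding Units_def by (auto simp: ring_mat_def)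
  show thesis
  proof (rule that[of "\<lambda>j i. B $$ (j, i)"])
    fix j k assume jk: "j \<le> d" "k \<le> d"
    have "(B * A) $$ (j, k) = (if j = k then 1 else 0)" using jk B(2) by simp
    then show "(\<Sum>i\<le>d. B $$ (j, i) * v k i) = (if j = k then 1 else 0)"
      using jk B(1) by (simp add: A_def scalar_prod_def atLeast0LessThan flip: lessThan_Suc_atMost)
    have "(A * B) $$ (j, k) = (if j = k then 1 else 0)" using jk B(3) by simp
    then show "(\<Sum>i\<le>d. v i j * B $$ (i, k)) = (if j = k then 1 else 0)"
      using jk B(1) by (simp add: A_def scalar_prod_def atLeast0LessThan flip: lessThan_Suc_atMost)
  qed
qed

text \<open>The parameter \<open>e\<close> is the sign of the curvature: \<open>1\<close> gives the
  Euclidean form, \<open>-1\<close> the Lorentzian one, so that the sphere and the hyperboloid share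
  the bilinear algebra.\<close>

definition form :: "real \<Rightarrow> nat \<Rightarrow> (nat \<Rightarrow> real) \<Rightarrow> (nat \<Rightarrow> real) \<Rightarrow> real" where
  "form e d x y = (\<Sum>i\<le>d. (if i = 0 then e else 1) * x i * y i)"

definition space_pts :: "real \<Rightarrow> nat \<Rightarrow> (nat \<Rightarrow> real) set" where
  "space_pts e d = {x \<in> ambient d. form e d x x = e \<and> (e = -1 \<longrightarrow> x 0 > 0)}"

text \<open>Named so that bilinearity becomes a rewrite rule; a multiple of \<open>x\<close> alone
  is \<open>comb a x 0 x\<close>.\<close>

definition comb :: "real \<Rightarrow> (nat \<Rightarrow> real) \<Rightarrow> real \<Rightarrow> (nat \<Rightarrow> real) \<Rightarrow> nat \<Rightarrow> real" where
  "comb a x b y = (\<lambda>i. a * x i + b * y i)"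

lemma form_split: "form e d x y = e * x 0 * y 0 + (\<Sum>i=1..d. x i * y i)"
proof -
  have "{..d} = insert 0 {1..d}" by auto
  then show ?thesis by (simp add: form_def)
qed

lemma lor_eq_form: "lor d = form (-1) d"
  by (intro ext) (simp add: lor_def form_split)

lemma eucl_eq_form: "eucl d = form 1 d"
  by (intro ext) (simp add: eucl_def form_def)

lemma hyp_eq_space_pts: "hyp d = space_pts (-1) d"
  by (simp add: hyp_def space_pts_def lor_eq_form)

lemma sph_eq_space_pts: "sph d = space_pts 1 d"
  by (simp add: sph_def space_pts_def eucl_eq_form)

lemma form_sym: "form e d x y = form e d y x"
  unfolding form_def by (intro sum.cong) auto

lemma form_comb_left: "form e d (comb a x b y) z = a * form e d x z + b * form e d y z"
  unfolding form_def comb_def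
  by (simp add: sum_distrib_left algebra_simps flip: sum.distrib)

lemma form_comb_right: "form e d z (comb a x b y) = a * form e d z x + b * form e d z y"
  using form_comb_left form_sym by metis

lemma form_sum_left: "form e d (\<lambda>i. \<Sum>j\<in>J. c j * v j i) z = (\<Sum>j\<in>J. c j * form e d (v j) z)"
  unfolding form_def sum_distrib_left sum_distrib_right
  by (subst sum.swap) (simp add: mult_ac)

lemma form_cong: "(\<And>i. i \<le> d \<Longrightarrow> x i = x' i) \<Longrightarrow> (\<And>i. i \<le> d \<Longrightarrow> y i = y' i) \<Longrightarrow> form e d x y = form e d x' y'"
  unfolding form_def by (intro sum.cong) auto

lemma ambient_eqI: "x \<in> ambient d \<Longrightarrow> y \<in> ambient d \<Longrightarrow> (\<And>i. i \<le> d \<Longrightarrow> x i = y i) \<Longrightarrow> x = y"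
  unfolding ambient_def by (intro ext) (metis (mono_tags) mem_Collect_eq not_le)

lemma ambient_comb: "x \<in> ambient d \<Longrightarrow> y \<in> ambient d \<Longrightarrow> comb a x b y \<in> ambient d"
  by (simp add: ambient_def comb_def)

lemma ambient_sum: "(\<And>j. j \<in> J \<Longrightarrow> v j \<in> ambient d) \<Longrightarrow> (\<lambda>i. \<Sum>j\<in>J. c j * v j i) \<in> ambient d"
  by (simp add: ambient_def)

lemma space_ptsD:
  assumes "x \<in> space_pts e d"
  shows "x \<in> ambient d" "form e d x x = e" "e = -1 \<Longrightarrow> x 0 > 0"
  using assms by (auto simp: space_pts_def)

lemma sum_Cauchy_Schwarz:
  fixes x y :: "nat \<Rightarrow> real"
  shows "(\<Sum>i\<in>I. x i * y i)\<^sup>2 \<le> (\<Sum>i\<in>I. x i * x i) * (\<Sum>i\<in>I. y i * y i)"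
proof (cases "finite I")
  case True
  have "0 \<le> (\<Sum>i\<in>I. \<Sum>j\<in>I. (x i * y j - x j * y i)\<^sup>2)" by (intro sum_nonneg) auto
  also have "\<dots> = (\<Sum>i\<in>I. \<Sum>j\<in>I. (x i * x i) * (y j * y j)) + (\<Sum>i\<in>I. \<Sum>j\<in>I. (y i * y i) * (x j * x j))
      - 2 * (\<Sum>i\<in>I. \<Sum>j\<in>I. (x i * y i) * (x j * y j))"
    by (simp add: power2_eq_square algebra_simps sum.distrib sum_subtractf sum_distrib_left)
  also have "\<dots> = 2 * ((\<Sum>i\<in>I. x i * x i) * (\<Sum>i\<in>I. y i * y i)) - 2 * (\<Sum>i\<in>I. x i * y i)\<^sup>2"
    unfolding sum_product[symmetric] by (simp add: power2_eq_square)
  finally show ?thesis by simp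
qed simp

section \<open>Products of projections orthogonal to a point\<close>

locale space_form =
  fixes e :: real and d :: nat
  assumes sign: "e = 1 \<or> e = -1"
begin

abbreviation B where "B \<equiv> form e d"
abbreviation M where "M \<equiv> space_pts e d"

text \<open>For \<open>c\<close> in \<open>M\<close>, where \<open>B c c = e\<close>, the projection
  of \<open>x\<close> is \<open>x\<close> minus \<open>e * B x c\<close> times \<open>c\<close>; the
  form of two such projections is exactly this expression.\<close>

definition pf :: "(nat \<Rightarrow> real) \<Rightarrow> (nat \<Rightarrow> real) \<Rightarrow> (nat \<Rightarrow> real) \<Rightarrow> real" where
  "pf c x y = B x y - e * B x c * B y c"

lemma e_sq: "e * e = 1" using sign by auto

text \<open>For \<open>e = -1\<close> the point \<open>c\<close> is timelike, so its orthogonal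
  complement is positive definite. Orthogonality identifies \<open>x 0 * c 0\<close> with the
  spatial product of \<open>x\<close> and \<open>c\<close>, to which Cauchy-Schwarz applies.\<close>

lemma orthogonal_definite:
  assumes c: "c \<in> M" and x: "B x c = 0"
  shows "B x x \<ge> 0" "B x x = 0 \<Longrightarrow> i \<le> d \<Longrightarrow> x i = 0"
proof -
  let ?s = "\<lambda>x y. (\<Sum>i=1..d. x i * y i :: real)"
  have xs: "?s x x \<ge> 0" by (intro sum_nonneg) auto
  have *: "B x x \<ge> 0 \<and> (B x x = 0 \<longrightarrow> x 0 = 0 \<and> ?s x x = 0)"
  proof (cases "e = 1")
    case True
    then show ?thesis using xs by (simp add: form_split add_nonneg_eq_0_iff)
  next
    case False
    then have e: "e = -1" using sign by simp
    have c0: "c 0 > 0" and cc: "?s c c = c 0 * c 0 - 1"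
      using space_ptsD[OF c] e by (auto simp: form_split)
    have "?s x c = x 0 * c 0" using x e by (simp add: form_split)
    then have CS: "(x 0 * c 0)\<^sup>2 \<le> ?s x x * (c 0 * c 0 - 1)"
      using sum_Cauchy_Schwarz[of x c "{1..d}"] cc by simp
    then have "c 0 * c 0 * (x 0 * x 0) \<le> c 0 * c 0 * ?s x x - ?s x x"
      by (simp add: power2_eq_square algebra_simps)
    then have "c 0 * c 0 * (?s x x - x 0 * x 0) \<ge> ?s x x" by (simp add: algebra_simps)
    moreover have "?s x x - x 0 * x 0 = B x x" using e by (simp add: form_split)
    \<comment> \<open>One inequality serves both claims: the spatial square of \<open>x\<close> is
      at most a positive multiple of \<open>B x x\<close>.\<close>
    ultimately have h: "c 0 * c 0 * B x x \<ge> ?s x x" by simp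
    have "c 0 * c 0 > 0" using c0 by simp
    then have "B x x \<ge> 0" using h xs by (smt (verit) mult_pos_neg)
    moreover have "?s x x = 0 \<and> x 0 = 0" if "B x x = 0"
    proof -
      have "?s x x = 0" using h that xs by simp
      moreover have "x 0 * x 0 = 0" using that \<open>?s x x = 0\<close> e by (simp add: form_split)
      ultimately show ?thesis by simp
    qed
    ultimately show ?thesis by simp
  qed
  then show "B x x \<ge> 0" by simp
  assume "B x x = 0" "i \<le> d"
  with * have "x 0 = 0" "?s x x = 0" by auto
  moreover have "x i = 0" if "i \<noteq> 0"
  proof -
    have "\<forall>i\<in>{1..d}. x i * x i = 0"
      using \<open>?s x x = 0\<close> by (subst (asm) sum_nonneg_eq_0_iff) auto
    then show ?thesis using that \<open>i \<le> d\<close> by auto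
  qed
  ultimately show "x i = 0" by auto
qed

lemma pf_sym: "pf c x y = pf c y x"
  by (simp add: pf_def form_sym mult_ac)

lemma pf_comb_left: "pf c (comb a x b y) z = a * pf c x z + b * pf c y z"
  by (simp add: pf_def form_comb_left algebra_simps)

lemma pf_comb_right: "pf c z (comb a x b y) = a * pf c z x + b * pf c z y"
  by (simp add: pf_def form_comb_left form_comb_right algebra_simps)

lemma
  assumes c: "c \<in> M"
  shows pf_nonneg: "pf c x x \<ge> 0"
    and pf_eq_0D: "pf c x x = 0 \<Longrightarrow> i \<le> d \<Longrightarrow> x i = e * B x c * c i"
proof -
  let ?x = "comb 1 x (- e * B x c) c"
  have cc: "B c c = e" using space_ptsD[OF c] by simp
  have "e * (e * B x c) = B x c" using e_sq by (metis mult.assoc mult_1)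
  then have 0: "B ?x c = 0" by (simp add: form_comb_left cc mult_ac)
  have 1: "B ?x ?x = pf c x x"
    by (subst form_comb_right) (simp add: 0, simp add: form_comb_left pf_def form_sym[of e d c x] mult_ac form_comb_right cc e_sq)
  show "pf c x x \<ge> 0" using orthogonal_definite(1)[OF c 0] 1 by simp
  assume "pf c x x = 0" "i \<le> d"
  then have "?x i = 0" using orthogonal_definite(2)[OF c 0] 1 by simp
  then show "x i = e * B x c * c i" by (simp add: comb_def)
qed

text \<open>Since \<open>c\<close> is in the kernel of \<open>pf c\<close>, the form is only
  semidefinite and vectors of length zero need a separate argument.\<close>

lemma pf_Cauchy_Schwarz:
  assumes c: "c \<in> M"
  shows "(pf c x y)\<^sup>2 \<le> pf c x x * pf c y y"
proof (cases "pf c y y = 0")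
  case True
  have *: "0 \<le> pf c x x + 2 * s * pf c x y" for s
    using pf_nonneg[OF c, of "comb 1 x s y"] True
    by (simp add: pf_comb_left pf_comb_right pf_sym[of c y x])
  have "pf c x y = 0"
  proof (rule ccontr)
    assume "pf c x y \<noteq> 0"
    \<comment> \<open>This \<open>s\<close> gives the linear expression the value
      \<open>-1\<close>.\<close>
    then show False using *[of "- (pf c x x + 1) / (2 * pf c x y)"] by (simp add: field_simps)
  qed
  then show ?thesis using True by simp
next
  case False
  then have pos: "pf c y y > 0" using pf_nonneg[OF c, of y] by simp
  have "0 \<le> pf c (comb (pf c y y) x (- pf c x y) y) (comb (pf c y y) x (- pf c x y) y)"
    by (rule pf_nonneg[OF c])
  also have "\<dots> = pf c y y * (pf c x x * pf c y y - (pf c x y)\<^sup>2)"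
    by (simp add: pf_comb_left pf_comb_right pf_sym[of c y x] power2_eq_square algebra_simps)
  finally show ?thesis using pos by (simp add: zero_le_mult_iff)
qed

lemma pf_le_sqrt: "c \<in> M \<Longrightarrow> pf c x y \<le> sqrt (pf c x x) * sqrt (pf c y y)"
  using pf_Cauchy_Schwarz by (simp add: real_le_rsqrt flip: real_sqrt_mult)

lemma pf_ge_sqrt: "c \<in> M \<Longrightarrow> - (sqrt (pf c x x) * sqrt (pf c y y)) \<le> pf c x y"
  using pf_le_sqrt[of c "comb (-1) x 0 x" y] by (simp add: pf_comb_left pf_comb_right)

text \<open>The value is the squared sine (\<open>e = 1\<close>) or hyperbolic sine
  (\<open>e = -1\<close>) of the distance from \<open>c\<close> to \<open>x\<close>.\<close>

lemma pf_self: "x \<in> M \<Longrightarrow> pf c x x = e * (1 - (B x c)\<^sup>2)"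
  by (simp add: pf_def space_ptsD power2_eq_square algebra_simps)

end

section \<open>The radius inequalities\<close>

text \<open>The vector \<open>g j\<close> is normal to the facet opposite to \<open>v j\<close>, and
  \<open>B (g j) x\<close> is the coordinate of \<open>x\<close> belonging to
  \<open>v j\<close>.\<close>

locale simplex = space_form +
  fixes v g :: "nat \<Rightarrow> nat \<Rightarrow> real"
  assumes v_in: "j \<le> d \<Longrightarrow> v j \<in> M"
    and dual: "j \<le> d \<Longrightarrow> k \<le> d \<Longrightarrow> B (g j) (v k) = (if j = k then 1 else 0)"
    and g_ambient: "j \<le> d \<Longrightarrow> g j \<in> ambient d"
    and expand: "x \<in> ambient d \<Longrightarrow> i \<le> d \<Longrightarrow> x i = (\<Sum>j\<le>d. B (g j) x * v j i)"
    and dim_pos: "d \<ge> 1"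
begin

lemma expand_form:
  assumes "x \<in> ambient d"
  shows "B x y = (\<Sum>j\<le>d. B (g j) x * B (v j) y)"
proof -
  have "B x y = B (\<lambda>i. \<Sum>j\<le>d. B (g j) x * v j i) y"
    using expand[OF assms] by (intro form_cong) auto
  then show ?thesis by (simp add: form_sum_left)
qed

lemma expand_form_self: "x \<in> M \<Longrightarrow> (\<Sum>j\<le>d. B (g j) x * B (v j) x) = e"
  using expand_form[of x x] space_ptsD[of x e d] by simp

text \<open>Pairing \<open>c\<close> with its own expansion in the vertices. These products act as
  weights; in the tight case each of them is \<open>1 / (d + 1)\<close>.\<close>

lemma expand_weights:
  assumes "c \<in> M"
  shows "(\<Sum>j\<le>d. e * B (v j) c * B (g j) c) = 1"
proof -
  have "(\<Sum>j\<le>d. e * B (v j) c * B (g j) c) = e * (\<Sum>j\<le>d. B (g j) c * B (v j) c)"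
    by (simp add: sum_distrib_left mult_ac)
  then show ?thesis using expand_form_self[OF assms] e_sq by simp
qed

lemma pf_dual:
  assumes "j \<le> d"
  shows "pf c (g j) (v j) = 1 - e * B (v j) c * B (g j) c"
  using dual[OF assms assms] by (simp add: pf_def)

text \<open>Each of the \<open>d + 1\<close> products is one minus a weight, and the weights add up
  to one.\<close>

lemma sum_pf_dual: "c \<in> M \<Longrightarrow> (\<Sum>j\<le>d. pf c (g j) (v j)) = d"
  using expand_weights[of c] by (simp add: pf_dual sum_subtractf)

text \<open>Otherwise all \<open>g j\<close> would be multiples of \<open>c\<close>, which
  \<open>B (g 0) (v 0) = 1\<close>, \<open>B (g 1) (v 0) = 0\<close> and
  \<open>B (g 1) (v 1) = 1\<close> exclude. On the sphere this keeps inner balls smaller than a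
  hemisphere.\<close>

lemma g_pf_pos:
  assumes c: "c \<in> M"
  shows "\<exists>j\<le>d. pf c (g j) (g j) > 0"
proof (rule ccontr)
  assume "\<not> ?thesis"
  then have 0: "pf c (g j) (g j) = 0" if "j \<le> d" for j
    using that pf_nonneg[OF c, of "g j"] by (metis less_eq_real_def)
  have *: "B (g j) x = e * B (g j) c * B c x" if "j \<le> d" for j x
  proof -
    have "B (g j) x = B (comb (e * B (g j) c) c 0 c) x"
      using pf_eq_0D[OF c 0[OF that]] by (intro form_cong) (auto simp: comb_def)
    then show ?thesis by (simp add: form_comb_left)
  qed
  have "B (g 0) (v 0) = 1" "B (g 1) (v 0) = 0" "B (g 1) (v 1) = 1" using dual dim_pos by auto
  then show False using * dim_pos by (metis mult_eq_0_iff mult_zero_left zero_le zero_neq_one)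
qed

text \<open>Equality forces every summand of the trace identity to be tight, so the projected vertices
  are a common multiple of the projected dual vectors.\<close>
lemma concentric_equality:
  fixes \<tau> t :: real
  assumes c: "c \<in> M" and tau: "\<tau> > 0" and eq: "d * \<tau> = t"
    and in_ball: "\<And>j. j \<le> d \<Longrightarrow> \<tau> * sqrt (pf c (g j) (g j)) \<le> B (g j) c"
    and out_ball: "\<And>j. j \<le> d \<Longrightarrow> sqrt (pf c (v j) (v j)) \<le> t * (e * B (v j) c)"
  shows "\<exists>b. \<forall>i\<le>d. \<forall>j\<le>d. i \<noteq> j \<longrightarrow> B (v i) (v j) = b"
proof -
  let ?a = "\<lambda>j. e * B (v j) c" and ?\<gamma> = "\<lambda>j. B (g j) c"
  let ?G = "\<lambda>j. sqrt (pf c (g j) (g j))" and ?V = "\<lambda>j. sqrt (pf c (v j) (v j))"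
  have d0: "real d > 0" using dim_pos by simp
  then have t: "t > 0" using mult_pos_pos[OF _ tau, of d] eq by simp
  have G0: "?G j \<ge> 0" and V0: "?V j \<ge> 0" for j using pf_nonneg[OF c] by auto
  have \<gamma>0: "?\<gamma> j \<ge> 0" if "j \<le> d" for j
    using order_trans[OF mult_nonneg_nonneg[OF less_imp_le[OF tau] G0] in_ball[OF that]] .
  have a0: "?a j \<ge> 0" if "j \<le> d" for j
    using order_trans[OF V0 out_ball[OF that]] t by (simp add: zero_le_mult_iff)
  \<comment> \<open>Product of the two ball conditions; \<open>t = d * \<tau>\<close> makes
    \<open>\<tau>\<close> cancel.\<close>
  have GV: "?G j * ?V j \<le> d * (?a j * ?\<gamma> j)" if "j \<le> d" for j
  proof -
    have "\<tau> * (?G j * ?V j) \<le> ?\<gamma> j * (t * ?a j)"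
      using mult_mono[OF in_ball[OF that] out_ball[OF that]] V0 \<gamma>0[OF that] by (simp add: mult_ac)
    also have "\<dots> = \<tau> * (d * (?a j * ?\<gamma> j))" using eq by (simp add: mult_ac)
    finally show ?thesis using tau by simp
  qed
  have term_le: "1 - ?a j * ?\<gamma> j \<le> d * (?a j * ?\<gamma> j)" if "j \<le> d" for j
    using pf_le_sqrt[OF c, of "g j" "v j"] GV[OF that] pf_dual[OF that, of c] by simp
  \<comment> \<open>The upper bounds in \<open>term_le\<close> add up to \<open>d\<close>, the lower
    sides to \<open>d + 1 - 1\<close>, so no summand has slack.\<close>
  have "(\<Sum>j\<le>d. d * (?a j * ?\<gamma> j) - (1 - ?a j * ?\<gamma> j)) = 0"
  proof -
    have "(\<Sum>j\<le>d. d * (?a j * ?\<gamma> j) - (1 - ?a j * ?\<gamma> j)) = d * (\<Sum>j\<le>d. ?a j * ?\<gamma> j) - (Suc d - (\<Sum>j\<le>d. ?a j * ?\<gamma> j))"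
      unfolding sum_subtractf sum_distrib_left[symmetric] by simp
    then show ?thesis using expand_weights[OF c] by simp
  qed
  then have term_eq: "d * (?a j * ?\<gamma> j) = 1 - ?a j * ?\<gamma> j" if "j \<le> d" for j
    using that term_le by (subst (asm) sum_nonneg_eq_0_iff) auto
  have ag: "?a j * ?\<gamma> j = 1 / (d + 1)" if "j \<le> d" for j
    using term_eq[OF that] by (simp add: field_simps)
  have apos: "?a j > 0" and \<gamma>pos: "?\<gamma> j > 0" if "j \<le> d" for j
    using ag[OF that] a0[OF that] \<gamma>0[OF that] by (auto simp: less_le)
  have GVeq: "?G j * ?V j = d / (d + 1)" if "j \<le> d" for j
  proof (rule antisym)
    show "?G j * ?V j \<le> d / (d + 1)" using GV[OF that] ag[OF that] by simp
    have "d / (d + 1) = 1 - ?a j * ?\<gamma> j" using term_eq[OF that] ag[OF that] by simp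
    then show "d / (d + 1) \<le> ?G j * ?V j"
      using pf_le_sqrt[OF c, of "g j" "v j"] pf_dual[OF that, of c] by simp
  qed
  have Geq: "?G j = ?\<gamma> j / \<tau>" and Veq: "?V j = t * ?a j" if "j \<le> d" for j
  proof -
    have G1: "?G j \<le> ?\<gamma> j / \<tau>" using in_ball[OF that] tau by (simp add: field_simps)
    \<comment> \<open>The two upper bounds have the same product as the lengths they bound, so
      neither length can be smaller than its bound.\<close>
    have "?\<gamma> j / \<tau> * (t * ?a j) = d * (?a j * ?\<gamma> j)" using eq tau by (auto simp: field_simps)
    also have "\<dots> = ?G j * ?V j" using GVeq[OF that] ag[OF that] by simp
    finally have E: "?\<gamma> j / \<tau> * (t * ?a j) = ?G j * ?V j" .
    have P: "?\<gamma> j / \<tau> > 0" "t * ?a j > 0" using \<gamma>pos[OF that] apos[OF that] t tau by auto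
    show GE: "?G j = ?\<gamma> j / \<tau>"
    proof (rule ccontr)
      assume "?G j \<noteq> ?\<gamma> j / \<tau>"
      then have "?G j < ?\<gamma> j / \<tau>" using G1 by simp
      then have "?G j * (t * ?a j) < ?\<gamma> j / \<tau> * (t * ?a j)" using P(2) by (rule mult_strict_right_mono)
      moreover have "?G j * ?V j \<le> ?G j * (t * ?a j)" using out_ball[OF that] G0 by (rule mult_left_mono)
      ultimately show False using E by simp
    qed
    then show "?V j = t * ?a j" using E P(1) unfolding GE by (metis less_irrefl mult_left_cancel)
  qed
  \<comment> \<open>The positive solution \<open>a\<close> of
    \<open>t\<^sup>2 * a\<^sup>2 = e * (1 - a\<^sup>2)\<close>, which says that the projected vertex
    has the tight length \<open>t * a\<close>.\<close>
  define A where "A = sqrt (e / (t\<^sup>2 + e))"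
  have aA: "?a j = A" if "j \<le> d" for j
  proof -
    have "(t * ?a j)\<^sup>2 = pf c (v j) (v j)"
      unfolding Veq[OF that, symmetric] using pf_nonneg[OF c] by simp
    then have "t\<^sup>2 * (?a j)\<^sup>2 = e * (1 - (B (v j) c)\<^sup>2)"
      unfolding power_mult_distrib[of t] pf_self[OF v_in[OF that]] .
    moreover have "(B (v j) c)\<^sup>2 = (?a j)\<^sup>2" using sign by auto
    ultimately have "t\<^sup>2 * (?a j)\<^sup>2 = e * (1 - (?a j)\<^sup>2)" by metis
    then have E: "(t\<^sup>2 + e) * (?a j)\<^sup>2 = e" unfolding distrib_right right_diff_distrib by simp
    have "t\<^sup>2 + e \<noteq> 0" using E sign by auto
    then have "(?a j)\<^sup>2 = e / (t\<^sup>2 + e)" using E by (simp add: field_simps)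
    then show ?thesis unfolding A_def using apos[OF that] by (metis less_imp_le real_sqrt_unique)
  qed
  define \<Gamma> where "\<Gamma> = 1 / ((d + 1) * A)"
  have Apos: "A > 0" using aA[of 0] apos[of 0] by simp
  have \<gamma>\<Gamma>: "?\<gamma> j = \<Gamma>" if "j \<le> d" for j
  proof -
    have "A * ?\<gamma> j = 1 / (d + 1)" using ag[OF that] unfolding aA[OF that] .
    then show ?thesis using Apos by (simp add: \<Gamma>_def eq_divide_eq mult_ac)
  qed
  define k where "k = t * A / (\<Gamma> / \<tau>)"
  have "B (v i) (v j) = e * A\<^sup>2 - k * (A * \<Gamma>)" if ij: "i \<le> d" "j \<le> d" "i \<noteq> j" for i j
  proof -
    \<comment> \<open>\<open>k * g j\<close> and \<open>v j\<close> have projections of equal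
      length, and equality in Cauchy-Schwarz makes the projection of their difference
      \<open>?N\<close> vanish. Products of \<open>v j\<close> with the other vertices thus reduce
      to those of \<open>g j\<close>, which duality determines.\<close>
    let ?N = "comb 1 (v j) (- k) (g j)"
    have Gj: "?G j = \<Gamma> / \<tau>" and Vj: "?V j = t * A" using Geq Veq \<gamma>\<Gamma> aA ij by auto
    have \<Gamma>pos: "\<Gamma> > 0" using \<gamma>pos[OF ij(2)] \<gamma>\<Gamma>[OF ij(2)] by simp
    have kG: "k * ?G j = ?V j" using Gj Vj \<Gamma>pos tau by (simp add: k_def)
    have pfgv: "pf c (g j) (v j) = ?G j * ?V j"
      using pf_dual[OF ij(2), of c] term_eq[OF ij(2)] GVeq[OF ij(2)] ag[OF ij(2)] by simp
    have sq: "pf c (g j) (g j) = (?G j)\<^sup>2" "pf c (v j) (v j) = (?V j)\<^sup>2" using pf_nonneg[OF c] by auto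
    have "pf c ?N ?N = (?V j)\<^sup>2 - 2 * k * (?G j * ?V j) + k\<^sup>2 * (?G j)\<^sup>2"
      using sq pfgv by (simp add: pf_comb_left pf_comb_right pf_sym[of c "v j" "g j"] power2_eq_square algebra_simps)
    also have "\<dots> = 0" unfolding kG[symmetric] by (simp add: power2_eq_square algebra_simps)
    finally have "(pf c ?N (v i))\<^sup>2 \<le> 0" using pf_Cauchy_Schwarz[OF c, of ?N "v i"] by simp
    then have "pf c (v j) (v i) = k * pf c (g j) (v i)" by (simp add: pf_comb_left)
    moreover have "pf c (g j) (v i) = - (A * \<Gamma>)"
      using dual[OF ij(2,1)] ij aA[OF ij(1)] \<gamma>\<Gamma>[OF ij(2)] by (simp add: pf_def mult_ac)
    moreover have "pf c (v j) (v i) = B (v i) (v j) - e * A\<^sup>2"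
    proof -
      have "B (v j) c = e * A" "B (v i) c = e * A"
        using aA ij sign by fastforce+
      then show ?thesis using e_sq by (simp add: pf_def form_sym[of e d "v j"] power2_eq_square)
    qed
    ultimately show ?thesis by (simp add: algebra_simps)
  qed
  then show ?thesis by blast
qed

text \<open>In the central projection from \<open>c\<close> the vertices sit at \<open>v j\<close>
  divided by \<open>e * B (v j) c\<close>; here all are shifted by the same multiple of
  \<open>p\<close>. The shift contributes a multiple of the sum of
  \<open>e * B (v j) c * pf c (g j) p\<close>, which is zero because the \<open>g j\<close> with
  these coefficients add up to a multiple of \<open>c\<close>.\<close>

lemma sum_recentred_pf:
  assumes c: "c \<in> M" and p: "p \<in> M"
  shows "(\<Sum>j\<le>d. pf c (g j) (comb 1 (v j) (- (e * B (v j) c * k)) p)) = d"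
proof -
  let ?a = "\<lambda>j. e * B (v j) c"
  have "(\<Sum>j\<le>d. ?a j * pf c (g j) p) = e * (\<Sum>j\<le>d. B (g j) p * B (v j) c) - e * B p c * (\<Sum>j\<le>d. ?a j * B (g j) c)"
    unfolding sum_distrib_left sum_subtractf[symmetric] by (intro sum.cong) (auto simp: pf_def algebra_simps)
  also have "\<dots> = 0" using expand_form[of p c] space_ptsD(1)[OF p] expand_weights[OF c] by simp
  finally have 0: "(\<Sum>j\<le>d. ?a j * pf c (g j) p) = 0" .
  have "(\<Sum>j\<le>d. pf c (g j) (comb 1 (v j) (- (?a j * k)) p)) = (\<Sum>j\<le>d. pf c (g j) (v j)) - k * (\<Sum>j\<le>d. ?a j * pf c (g j) p)"
    unfolding sum_distrib_left sum_subtractf[symmetric] by (intro sum.cong) (auto simp: pf_comb_right algebra_simps)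
  then show ?thesis using 0 sum_pf_dual[OF c] by simp
qed

end

text \<open>The reversed Cauchy-Schwarz inequality on the upper sheet: after the spatial inequality,
  what remains is that \<open>(x 0 * x 0 - 1) * (y 0 * y 0 - 1)\<close> is smaller than
  \<open>(x 0 * y 0 - 1)\<^sup>2\<close> by a square, namely that of
  \<open>x 0 - y 0\<close>.\<close>

lemma hyp_form_le:
  assumes x: "x \<in> space_pts (-1) d" and y: "y \<in> space_pts (-1) d"
  shows "form (-1) d x y \<le> -1"
proof -
  interpret space_form "-1" d by unfold_locales auto
  let ?s = "\<lambda>x y. (\<Sum>i=1..d. x i * y i :: real)"
  have x0: "x 0 > 0" "?s x x = x 0 * x 0 - 1" and y0: "y 0 > 0" "?s y y = y 0 * y 0 - 1"
    using space_ptsD[OF x] space_ptsD[OF y] by (auto simp: form_split)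
  have "(?s x y)\<^sup>2 \<le> (x 0 * x 0 - 1) * (y 0 * y 0 - 1)"
    using sum_Cauchy_Schwarz[of x y "{1..d}"] x0 y0 by simp
  also have "\<dots> \<le> (x 0 * y 0 - 1)\<^sup>2"
    using sum_power2_ge_zero[of "x 0 - y 0" 0] by (simp add: power2_eq_square algebra_simps)
  finally have 1: "\<bar>?s x y\<bar> \<le> \<bar>x 0 * y 0 - 1\<bar>" by (simp add: abs_le_square_iff)
  have "x 0 * x 0 \<ge> 1" "y 0 * y 0 \<ge> 1"
    using x0 y0 sum_nonneg[of "{1..d}" "\<lambda>i. x i * x i"] sum_nonneg[of "{1..d}" "\<lambda>i. y i * y i"] by auto
  then have "x 0 \<ge> 1" "y 0 \<ge> 1"
    using x0(1) y0(1) by (metis (no_types, opaque_lifting) less_imp_le mult_less_cancel_right1 mult_1 not_le mult_strict_mono order.strict_trans2)+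
  then have "x 0 * y 0 \<ge> 1" by (metis mult_mono mult_1 zero_le_one order_trans)
  then show ?thesis using 1 by (simp add: form_split)
qed

text \<open>The left side is the squared length of a recentred vertex, with \<open>P\<close> and
  \<open>C\<close> the hyperbolic cosines of the distance between the centres and of the outer
  radius. The subtracted term on the right is positive for \<open>P > 1\<close>,
  \<open>C > 1\<close>, \<open>a > 0\<close>; it is what later forces the centres together.\<close>

lemma recentred_vertex_bound:
  fixes a y P C :: real
  assumes "a \<ge> 0" "P > 0" "C > 0" "y \<ge> a * P - C"
  shows "a\<^sup>2 - 1 - 2 * (a * (1 / (P * C\<^sup>2))) * y + (a * (1 / (P * C\<^sup>2)))\<^sup>2 * (P\<^sup>2 - 1)
    \<le> a\<^sup>2 * (1 - 1 / C\<^sup>2) - a\<^sup>2 * (1 / C\<^sup>2) * (1 - 1 / C\<^sup>2) * (1 - 1 / P\<^sup>2)"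
proof -
  define u w where "u = 1 / P" and "w = 1 / C"
  have uw: "u * P = 1" "w * C = 1" "u > 0" "w > 0" using assms by (auto simp: u_def w_def)
  have k: "1 / (P * C\<^sup>2) = u * w\<^sup>2" "1 / C\<^sup>2 = w\<^sup>2" "1 / P\<^sup>2 = u\<^sup>2"
    by (auto simp: u_def w_def power_divide)
  \<comment> \<open>This expression is the right side of the claim minus the left side. The factor
    \<open>1 / (P * C\<^sup>2)\<close>, here \<open>u * w\<^sup>2\<close>, makes the difference a
    square plus a multiple of the slack in the bound for \<open>y\<close>.\<close>
  have "0 \<le> (1 - a * u * w)\<^sup>2 + 2 * a * u * w\<^sup>2 * (y - (a * P - C))"
    using assms uw by (intro add_nonneg_nonneg mult_nonneg_nonneg) auto
  also have "\<dots> = 1 - 2 * a * u * w + a\<^sup>2 * u\<^sup>2 * w\<^sup>2 + 2 * a * u * w\<^sup>2 * y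
      - 2 * a\<^sup>2 * w\<^sup>2 * (u * P) + 2 * a * u * w * (w * C)"
    by (simp add: power2_eq_square algebra_simps)
  also have "\<dots> = 1 + a\<^sup>2 * u\<^sup>2 * w\<^sup>2 + 2 * a * u * w\<^sup>2 * y - 2 * a\<^sup>2 * w\<^sup>2" using uw by simp
  also have "\<dots> = a\<^sup>2 * (1 - w\<^sup>2) - a\<^sup>2 * w\<^sup>2 * (1 - w\<^sup>2) * (1 - u\<^sup>2)
     - (a\<^sup>2 - 1 - 2 * (a * (u * w\<^sup>2)) * y + a\<^sup>2 * w\<^sup>2 * w\<^sup>2 * ((u * P)\<^sup>2 - u\<^sup>2))"
    using uw(1) by (simp add: power2_eq_square algebra_simps)
  also have "\<dots> = a\<^sup>2 * (1 - w\<^sup>2) - a\<^sup>2 * w\<^sup>2 * (1 - w\<^sup>2) * (1 - u\<^sup>2)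
     - (a\<^sup>2 - 1 - 2 * (a * (u * w\<^sup>2)) * y + (a * (u * w\<^sup>2))\<^sup>2 * (P\<^sup>2 - 1))"
    by (simp add: power2_eq_square algebra_simps)
  finally show ?thesis unfolding k by simp
qed

locale hyp_simplex = simplex "-1"
begin

text \<open>In the Klein model centred at \<open>c\<close>, a hyperbolic ball of radius \<open>R\<close> lies in a Euclidean ball
  of radius \<open>tanh R\<close>; its centre is the projection of \<open>p\<close> scaled by \<open>1 / (P * C\<^sup>2)\<close>.\<close>
lemma radius_inequality:
  fixes \<tau> C :: real
  assumes c: "c \<in> M" and p: "p \<in> M" and tau: "\<tau> \<ge> 0" and C: "C \<ge> 1"
    and in_ball: "\<And>j. j \<le> d \<Longrightarrow> \<tau> * sqrt (pf c (g j) (g j)) \<le> B (g j) c"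
    and out_ball: "\<And>j. j \<le> d \<Longrightarrow> - B p (v j) \<le> C"
  shows "d * \<tau> \<le> sqrt (1 - 1 / C\<^sup>2)"
    and "C > 1 \<Longrightarrow> d * \<tau> = sqrt (1 - 1 / C\<^sup>2) \<Longrightarrow> p = c"
proof -
  define P where "P = - B p c"
  have P1: "P \<ge> 1" using hyp_form_le[OF p c] by (simp add: P_def)
  define k where "k = 1 / (P * C\<^sup>2)"
  let ?a = "\<lambda>j. - 1 * B (v j) c"
  let ?t = "sqrt (1 - 1 / C\<^sup>2)"
  \<comment> \<open>\<open>W j\<close> projects to \<open>?a j\<close> times the offset of the
    vertex, in the Klein model at \<open>c\<close>, from the centre of the Euclidean ball.\<close>
  define W where "W = (\<lambda>j. comb 1 (v j) (- (?a j * k)) p)"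
  have C2: "1 / C\<^sup>2 \<le> 1" using C by (simp add: field_simps)
  have a1: "?a j \<ge> 1" if "j \<le> d" for j using hyp_form_le[OF v_in[OF that] c] by simp
  have W: "pf c (W j) (W j) \<le> (?a j)\<^sup>2 * (1 - 1 / C\<^sup>2) - (?a j)\<^sup>2 * (1 / C\<^sup>2) * (1 - 1 / C\<^sup>2) * (1 - 1 / P\<^sup>2)"
    if j: "j \<le> d" for j
  proof -
    have 1: "pf c (v j) (v j) = (?a j)\<^sup>2 - 1" "pf c p p = P\<^sup>2 - 1"
      using pf_self[OF v_in[OF j]] pf_self[OF p] by (auto simp: P_def)
    have "pf c (v j) p = B (v j) p + ?a j * P" by (simp add: pf_def P_def)
    then have 2: "pf c (v j) p \<ge> ?a j * P - C" using out_ball[OF j] form_sym[of "-1" d p "v j"] by simp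
    have "pf c (W j) (W j) = pf c (v j) (v j) - 2 * (?a j * k) * pf c (v j) p + (?a j * k)\<^sup>2 * pf c p p"
      unfolding W_def
      by (simp add: pf_comb_left pf_comb_right pf_sym[of c p "v j"] power2_eq_square algebra_simps)
    then show ?thesis unfolding 1 k_def
      using recentred_vertex_bound[OF _ _ _ 2] a1[OF j] P1 C by simp
  qed
  have Wle: "sqrt (pf c (W j) (W j)) \<le> ?a j * ?t" if j: "j \<le> d" for j
  proof -
    have "(?a j)\<^sup>2 * (1 / C\<^sup>2) * (1 - 1 / C\<^sup>2) * (1 - 1 / P\<^sup>2) \<ge> 0"
      using C2 P1 by (intro mult_nonneg_nonneg) (auto simp: field_simps)
    then have "pf c (W j) (W j) \<le> (?a j)\<^sup>2 * (1 - 1 / C\<^sup>2)" using W[OF j] by linarith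
    then have "sqrt (pf c (W j) (W j)) \<le> sqrt ((?a j)\<^sup>2 * (1 - 1 / C\<^sup>2))" by (rule real_sqrt_le_mono)
    also have "\<dots> = ?a j * ?t" using a1[OF j] by (simp add: real_sqrt_mult)
    finally show ?thesis .
  qed
  have G0: "sqrt (pf c x x) \<ge> 0" for x using pf_nonneg[OF c] by simp
  have \<gamma>0: "B (g j) c \<ge> 0" if "j \<le> d" for j
    using order_trans[OF mult_nonneg_nonneg[OF tau G0] in_ball[OF that]] .
  have main: "d * \<tau> \<le> (\<Sum>j\<le>d. B (g j) c * sqrt (pf c (W j) (W j)))"
  proof -
    have "d * \<tau> = (\<Sum>j\<le>d. \<tau> * pf c (g j) (W j))"
      using sum_recentred_pf[OF c p, of k] by (simp add: W_def flip: sum_distrib_left)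
    also have "\<dots> \<le> (\<Sum>j\<le>d. B (g j) c * sqrt (pf c (W j) (W j)))"
    proof (rule sum_mono)
      fix j assume "j \<in> {..d}" then have j: "j \<le> d" by simp
      have "\<tau> * pf c (g j) (W j) \<le> \<tau> * (sqrt (pf c (g j) (g j)) * sqrt (pf c (W j) (W j)))"
        using pf_le_sqrt[OF c] tau by (rule mult_left_mono)
      also have "\<dots> \<le> B (g j) c * sqrt (pf c (W j) (W j))"
        using mult_right_mono[OF in_ball[OF j] G0, of "W j"] by (simp add: mult_ac)
      finally show "\<tau> * pf c (g j) (W j) \<le> B (g j) c * sqrt (pf c (W j) (W j))" .
    qed
    finally show ?thesis .
  qed
  have tot: "(\<Sum>j\<le>d. B (g j) c * (?a j * ?t)) = ?t"
  proof -
    have "(\<Sum>j\<le>d. B (g j) c * (?a j * ?t)) = (\<Sum>j\<le>d. ?a j * B (g j) c) * ?t"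
      unfolding sum_distrib_right by (intro sum.cong) auto
    then show ?thesis using expand_weights[OF c] by simp
  qed
  have "(\<Sum>j\<le>d. B (g j) c * sqrt (pf c (W j) (W j))) \<le> (\<Sum>j\<le>d. B (g j) c * (?a j * ?t))"
    using Wle \<gamma>0 by (intro sum_mono mult_left_mono) auto
  then show "d * \<tau> \<le> ?t" using main tot by simp
  assume C1: "C > 1" and eq: "d * \<tau> = ?t"
  \<comment> \<open>If the centres were distinct, the extra term of the vertex bound would make
    every length estimate strict, and some index carries a positive coefficient
    \<open>B (g j) c\<close>.\<close>
  have "P = 1"
  proof (rule ccontr)
    assume "P \<noteq> 1"
    then have "P > 1" using P1 by simp
    have Wlt: "sqrt (pf c (W j) (W j)) < ?a j * ?t" if j: "j \<le> d" for j
    proof -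
      have "(?a j)\<^sup>2 * (1 / C\<^sup>2) * (1 - 1 / C\<^sup>2) * (1 - 1 / P\<^sup>2) > 0"
        using C1 \<open>P > 1\<close> a1[OF j] by (intro mult_pos_pos) (auto simp: field_simps)
      then have "pf c (W j) (W j) < (?a j)\<^sup>2 * (1 - 1 / C\<^sup>2)" using W[OF j] by linarith
      then have "sqrt (pf c (W j) (W j)) < sqrt ((?a j)\<^sup>2 * (1 - 1 / C\<^sup>2))" by (rule real_sqrt_less_mono)
      also have "\<dots> = ?a j * ?t" using a1[OF j] by (simp add: real_sqrt_mult)
      finally show ?thesis .
    qed
    have "\<exists>j\<le>d. B (g j) c \<noteq> 0"
    proof (rule ccontr)
      assume "\<not> ?thesis"
      then have "(\<Sum>j\<le>d. ?a j * B (g j) c) = 0" by (intro sum.neutral) auto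
      then show False using expand_weights[OF c] by simp
    qed
    then obtain j where j: "j \<le> d" "B (g j) c > 0" using \<gamma>0 by (metis less_eq_real_def)
    have "(\<Sum>j\<le>d. B (g j) c * sqrt (pf c (W j) (W j))) < (\<Sum>j\<le>d. B (g j) c * (?a j * ?t))"
    proof (rule sum_strict_mono_ex1)
      show "\<forall>j\<in>{..d}. B (g j) c * sqrt (pf c (W j) (W j)) \<le> B (g j) c * (?a j * ?t)"
        using Wle \<gamma>0 by (intro ballI mult_left_mono) auto
      show "\<exists>j\<in>{..d}. B (g j) c * sqrt (pf c (W j) (W j)) < B (g j) c * (?a j * ?t)"
        using j Wlt[OF j(1)] by (intro bexI[of _ j] mult_strict_left_mono) auto
    qed simp
    then show False using main tot eq by simp
  qed
  then have "pf c p p = 0" using pf_self[OF p, of c] by (simp add: P_def power2_eq_1_iff)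
  from pf_eq_0D[OF c this] show "p = c" using \<open>P = 1\<close> space_ptsD(1)[OF p] space_ptsD(1)[OF c]
    by (intro ambient_eqI) (auto simp: P_def)
qed

end

section \<open>The spherical estimate\<close>

locale sph_simplex = simplex 1
begin

text \<open>Here \<open>s\<close>, \<open>k\<close>, \<open>C\<close> stand for
  \<open>sin r\<close>, \<open>cos r\<close>, \<open>cos R\<close>, and all projections are taken at
  \<open>p\<close>. Summing the bounds for \<open>g j\<close> and \<open>v j\<close> collapses by
  expansion to a multiple of \<open>B c p - s\<^sup>2\<close>. This is at most
  \<open>k\<^sup>2\<close>, with equality only if \<open>B c p = 1\<close>.\<close>

lemma radius_inequality:
  fixes s k C :: real
  assumes c: "c \<in> M" and p: "p \<in> M" and s: "s \<ge> 0" and k: "k > 0" and sk: "s\<^sup>2 + k\<^sup>2 = 1"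
    and C: "C > 0"
    and in_ball: "\<And>j. j \<le> d \<Longrightarrow> s * sqrt (pf c (g j) (g j)) \<le> k * B (g j) c"
    and out_ball: "\<And>j. j \<le> d \<Longrightarrow> B p (v j) \<ge> C"
  shows "d * (s / k) \<le> sqrt (1 - C\<^sup>2) / C"
    and "C < 1 \<Longrightarrow> d * (s / k) = sqrt (1 - C\<^sup>2) / C \<Longrightarrow> p = c"
proof -
  let ?T = "sqrt (1 - C\<^sup>2) / C"
  have le1: "B x y \<le> 1" if "x \<in> M" "y \<in> M" for x y
    using pf_self[OF that(1), of y] pf_nonneg[OF that(2), of x] by (simp add: abs_square_le_1)
  have C1: "C \<le> 1" using out_ball[of 0] le1[OF p v_in[of 0]] by simp
  then have T0: "?T \<ge> 0" using C by (simp add: power_le_one)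
  have a: "B (v j) p \<ge> C" if "j \<le> d" for j using out_ball[OF that] form_sym by metis
  have G0: "sqrt (pf q x x) \<ge> 0" if "q \<in> M" for q x using pf_nonneg[OF that] by simp
  have V: "sqrt (pf p (v j) (v j)) \<le> ?T * B (v j) p" if j: "j \<le> d" for j
  proof (rule real_le_lsqrt)
    show "0 \<le> ?T * B (v j) p" using T0 a[OF j] C by (intro mult_nonneg_nonneg) auto
    have "C\<^sup>2 \<le> (B (v j) p)\<^sup>2" using a[OF j] C by (intro power_mono) auto
    then have "C\<^sup>2 * (1 - (B (v j) p)\<^sup>2) \<le> (1 - C\<^sup>2) * (B (v j) p)\<^sup>2" by (simp add: algebra_simps)
    then have "1 - (B (v j) p)\<^sup>2 \<le> (1 - C\<^sup>2) / C\<^sup>2 * (B (v j) p)\<^sup>2" using C by (simp add: field_simps)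
    then show "pf p (v j) (v j) \<le> (?T * B (v j) p)\<^sup>2"
      using C C1 pf_self[OF v_in[OF j], of p] by (simp add: power_mult_distrib power_divide power_le_one)
  qed
  \<comment> \<open>The condition at \<open>c\<close> amounts to
    \<open>s\<^sup>2 * B (g j) (g j) \<le> (B (g j) c)\<^sup>2\<close>. Splitting
    \<open>B (g j) (g j)\<close> at \<open>p\<close> into two squares and applying Cauchy-Schwarz in
    the plane with the unit vector \<open>(s, k)\<close> transfers it to \<open>p\<close>.\<close>
  have G: "s * k * sqrt (pf p (g j) (g j)) \<le> B (g j) c - s\<^sup>2 * B (g j) p" if j: "j \<le> d" for j
  proof -
    let ?\<gamma> = "B (g j) c" and ?\<pi> = "B (g j) p" and ?G = "sqrt (pf p (g j) (g j))"
    have "0 \<le> k * ?\<gamma>"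
      using order_trans[OF mult_nonneg_nonneg[OF s G0[OF c]] in_ball[OF j]] .
    then have \<gamma>0: "?\<gamma> \<ge> 0" using k by (simp add: zero_le_mult_iff)
    have "(s * sqrt (pf c (g j) (g j)))\<^sup>2 \<le> (k * ?\<gamma>)\<^sup>2" using in_ball[OF j] s G0[OF c] by (intro power_mono) auto
    then have "s\<^sup>2 * (B (g j) (g j) - ?\<gamma>\<^sup>2) \<le> k\<^sup>2 * ?\<gamma>\<^sup>2"
      using pf_nonneg[OF c, of "g j"] pf_def[of c "g j" "g j"] by (simp add: power_mult_distrib power2_eq_square[of "B (g j) c"])
    moreover have "(s\<^sup>2 + k\<^sup>2) * ?\<gamma>\<^sup>2 = ?\<gamma>\<^sup>2" using sk by simp
    ultimately have 1: "s\<^sup>2 * B (g j) (g j) \<le> ?\<gamma>\<^sup>2" by (simp add: algebra_simps)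
    have 2: "B (g j) (g j) = ?\<pi>\<^sup>2 + ?G\<^sup>2" using pf_nonneg[OF p, of "g j"] by (simp add: pf_def power2_eq_square)
    have "(s * ?\<pi> + k * ?G)\<^sup>2 \<le> (s\<^sup>2 + k\<^sup>2) * (?\<pi>\<^sup>2 + ?G\<^sup>2)"
      using zero_le_power2[of "s * ?G - k * ?\<pi>"] by (simp add: power2_eq_square algebra_simps)
    then have "s\<^sup>2 * (s * ?\<pi> + k * ?G)\<^sup>2 \<le> s\<^sup>2 * B (g j) (g j)"
      unfolding sk 2[symmetric] mult_1 by (rule mult_left_mono) simp
    then have "(s * (s * ?\<pi> + k * ?G))\<^sup>2 \<le> ?\<gamma>\<^sup>2" using 1 unfolding power_mult_distrib[of s] by linarith
    then have "s * (s * ?\<pi> + k * ?G) \<le> ?\<gamma>" using \<gamma>0 by (rule power2_le_imp_le)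
    then show ?thesis by (simp add: power2_eq_square algebra_simps)
  qed
  have "d * (s * k) = (\<Sum>j\<le>d. s * k * pf p (g j) (v j))"
    using sum_pf_dual[OF p] by (simp flip: sum_distrib_left)
  also have "\<dots> \<le> (\<Sum>j\<le>d. (B (g j) c - s\<^sup>2 * B (g j) p) * (?T * B (v j) p))"
  proof (rule sum_mono)
    fix j assume "j \<in> {..d}" then have j: "j \<le> d" by simp
    have sk0: "s * k \<ge> 0" using s k by simp
    have "s * k * pf p (g j) (v j) \<le> s * k * (sqrt (pf p (g j) (g j)) * sqrt (pf p (v j) (v j)))"
      using pf_le_sqrt[OF p] sk0 by (rule mult_left_mono)
    also have "\<dots> = (s * k * sqrt (pf p (g j) (g j))) * sqrt (pf p (v j) (v j))" by simp
    also have "\<dots> \<le> (B (g j) c - s\<^sup>2 * B (g j) p) * (?T * B (v j) p)"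
    proof (rule mult_mono[OF G[OF j] V[OF j]])
      show "0 \<le> B (g j) c - s\<^sup>2 * B (g j) p"
        using G[OF j] mult_nonneg_nonneg[OF sk0 G0[OF p, of "g j"]] by simp
    qed (rule G0[OF p])
    finally show "s * k * pf p (g j) (v j) \<le> (B (g j) c - s\<^sup>2 * B (g j) p) * (?T * B (v j) p)" .
  qed
  also have "\<dots> = ?T * ((\<Sum>j\<le>d. B (g j) c * B (v j) p) - s\<^sup>2 * (\<Sum>j\<le>d. B (g j) p * B (v j) p))"
    unfolding sum_distrib_left sum_subtractf[symmetric] by (intro sum.cong) (auto simp: algebra_simps)
  also have "\<dots> = ?T * (B c p - s\<^sup>2)"
    using expand_form[of c p] space_ptsD(1)[OF c] expand_form_self[OF p] by simp
  finally have main: "d * (s * k) \<le> ?T * (B c p - s\<^sup>2)" .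
  have k2: "k\<^sup>2 = 1 - s\<^sup>2" using sk by simp
  have dk: "d * (s / k) * k\<^sup>2 = d * (s * k)" using k by (simp add: power2_eq_square)
  have "?T * (B c p - s\<^sup>2) \<le> ?T * k\<^sup>2" using le1[OF c p] k2 T0 by (intro mult_left_mono) auto
  then have "d * (s / k) * k\<^sup>2 \<le> ?T * k\<^sup>2" using main dk by simp
  then show "d * (s / k) \<le> ?T" using k by (metis mult_right_le_imp_le zero_less_power)
  assume "C < 1" and eq: "d * (s / k) = ?T"
  then have "C * C < 1 * 1" using C by (intro mult_strict_mono) auto
  then have Tpos: "?T > 0" using C by (simp add: power2_eq_square)
  have "?T * k\<^sup>2 \<le> ?T * (B c p - s\<^sup>2)" using main dk unfolding eq by linarith
  from mult_left_le_imp_le[OF this Tpos] have "B c p \<ge> 1" using k2 by simp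
  then have 1: "B p c = 1" using le1[OF c p] form_sym[of 1 d c p] by simp
  then have "pf c p p = 0" using pf_self[OF p, of c] by simp
  from pf_eq_0D[OF c this] show "p = c" using 1 space_ptsD(1)[OF p] space_ptsD(1)[OF c]
    by (intro ambient_eqI) auto
qed

end

section \<open>Geodesics and the hull of the vertices\<close>

context space_form
begin

text \<open>Handles segments on which one of the two coefficients vanishes.\<close>

lemma scaled_point_eq:
  assumes x: "x \<in> M" and z: "z \<in> M" and a: "a \<ge> 0" and eq: "z = comb a x 0 y"
  shows "z = x"
proof -
  have "B z z = a * (a * B x x)" unfolding eq by (simp add: form_comb_left form_comb_right)
  then have "a * a * e = e" using space_ptsD[OF x] space_ptsD[OF z] by simp
  then have "a * a = 1" using sign by auto
  then have "a = 1" using a by (metis abs_of_nonneg abs_mult_self_eq real_sqrt_abs2 real_sqrt_one)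
  then show ?thesis using eq by (simp add: comb_def)
qed

lemma normalize_in:
  assumes "x \<in> ambient d" "e * B x x > 0" "e = -1 \<Longrightarrow> x 0 > 0"
  shows "comb (1 / sqrt (e * B x x)) x 0 x \<in> M"
proof -
  let ?n = "sqrt (e * B x x)"
  have n: "?n > 0" "?n * ?n = e * B x x" using assms(2) by auto
  have "B (comb (1 / ?n) x 0 x) (comb (1 / ?n) x 0 x) = B x x / (?n * ?n)"
    by (simp add: form_comb_left form_comb_right)
  also have "\<dots> = e" unfolding n(2) using assms(2) sign by auto
  finally show ?thesis using assms n unfolding space_pts_def by (auto simp: ambient_comb) (simp add: comb_def)
qed

text \<open>The projections of \<open>x\<close> and \<open>y\<close> orthogonal to a point \<open>z\<close> between them are antiparallel.\<close>
lemma pf_between: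
  assumes z: "z \<in> M" and ab: "a > 0" "b > 0" and eq: "z = comb a x b y"
  shows "pf z x y = - (sqrt (pf z x x) * sqrt (pf z y y))" "a * sqrt (pf z x x) = b * sqrt (pf z y y)"
proof -
  \<comment> \<open>\<open>z\<close> projects to zero at itself, so its representation by
    \<open>x\<close> and \<open>y\<close> becomes a linear relation between their
    projections.\<close>
  have "pf z z w = 0" for w using space_ptsD[OF z] e_sq
    by (simp add: pf_def form_sym[of e d w z])
  then have 0: "a * pf z x x + b * pf z x y = 0" "a * pf z x y + b * pf z y y = 0"
    using pf_comb_left[of z a x b y] eq pf_sym[of z x y] by metis+
  have nn: "pf z x x \<ge> 0" "pf z y y \<ge> 0" using pf_nonneg[OF z] by auto
  have "a * (a * pf z x x) = b * (b * pf z y y)"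
  proof -
    have "a * pf z x x = - (b * pf z x y)" "b * pf z y y = - (a * pf z x y)" using 0 by linarith+
    then show ?thesis by simp
  qed
  then have "(a * sqrt (pf z x x))\<^sup>2 = (b * sqrt (pf z y y))\<^sup>2"
    using nn by (simp add: power_mult_distrib) (simp add: power2_eq_square mult_ac)
  then show *: "a * sqrt (pf z x x) = b * sqrt (pf z y y)"
    by (rule power2_eq_imp_eq) (use ab nn in auto)
  have "b * pf z x y = - (a * sqrt (pf z x x)) * sqrt (pf z x x)"
    using 0(1) nn by (simp add: mult.assoc)
  also have "\<dots> = b * - (sqrt (pf z x x) * sqrt (pf z y y))" unfolding * by simp
  finally show "pf z x y = - (sqrt (pf z x x) * sqrt (pf z y y))"
    using ab(2) by (metis less_irrefl mult_left_cancel)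
qed

text \<open>With \<open>k\<close>, \<open>s\<close> the cosine and sine (or hyperbolic ones) of a
  radius, the point is reached from \<open>c\<close> by moving that far against the projected
  direction of \<open>g\<close>: it is \<open>k\<close> times \<open>c\<close> minus
  \<open>s / n\<close> times that projection, of length \<open>n\<close>. In a ball around
  \<open>c\<close> this is the boundary point closest to the facet with normal
  \<open>g\<close>.\<close>

lemma geodesic_point:
  assumes c: "c \<in> M" and pos: "pf c g g > 0" and ks: "e * k\<^sup>2 + s\<^sup>2 = e" and g: "g \<in> ambient d"
  shows "\<exists>x\<in>ambient d. B x x = e \<and> B c x = e * k \<and> B g x = k * B g c - s * sqrt (pf c g g)"
proof -
  define G where "G = comb 1 g (- (e * B g c)) c"
  define n where "n = sqrt (pf c g g)"
  have n: "n > 0" "n * n = pf c g g" using pos by (auto simp: n_def)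
  have cc: "B c c = e" using space_ptsD[OF c] by simp
  have 1: "B c G = 0" "B g G = n * n"
    using e_sq by (simp_all add: G_def form_comb_right cc form_sym[of e d c g] n(2) pf_def)
  have 2: "B G G = n * n"
    by (subst G_def) (simp add: form_comb_left 1)
  let ?x = "comb k c (- (s / n)) G"
  show ?thesis
  proof (intro bexI conjI)
    show "?x \<in> ambient d" unfolding G_def using g space_ptsD[OF c] by (intro ambient_comb) auto
    have "B ?x ?x = k * (k * e) + s / n * (s / n) * (n * n)"
      by (simp add: form_comb_left form_comb_right 1 2 cc form_sym[of e d G c])
    also have "\<dots> = e * k\<^sup>2 + s\<^sup>2" using n pos by (simp add: power2_eq_square)
    finally show "B ?x ?x = e" using ks by simp
    show "B c ?x = e * k" by (simp add: form_comb_right 1 cc)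
    show "B g ?x = k * B g c - s * sqrt (pf c g g)"
      using n(1) by (simp add: form_comb_right 1(2) field_simps flip: n_def)
  qed
qed

end

text \<open>All that the hull needs to know about a metric: betweenness is being a non-negative
  linear combination. The exception \<open>y = comb (-1) x 0 x\<close> is the antipodal pair on the
  sphere, where every point is between.\<close>

definition geodesic_dist :: "real \<Rightarrow> nat \<Rightarrow> ((nat \<Rightarrow> real) \<Rightarrow> (nat \<Rightarrow> real) \<Rightarrow> real) \<Rightarrow> bool" where
  "geodesic_dist e d \<delta> \<longleftrightarrow>
    (\<forall>x\<in>space_pts e d. \<forall>y\<in>space_pts e d. \<forall>z\<in>space_pts e d. \<delta> x z + \<delta> z y = \<delta> x y \<longrightarrow>
       (\<exists>a b. a \<ge> 0 \<and> b \<ge> 0 \<and> z = comb a x b y) \<or> y = comb (-1) x 0 x) \<and>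
    (\<forall>x\<in>space_pts e d. \<forall>y\<in>space_pts e d. \<forall>z\<in>space_pts e d. \<forall>a\<ge>0. \<forall>b\<ge>0. z = comb a x b y \<longrightarrow>
       \<delta> x z + \<delta> z y = \<delta> x y)"

lemma hdist_props:
  assumes "x \<in> hyp d" "y \<in> hyp d"
  shows "cosh (hdist d x y) = - form (-1) d x y" "hdist d x y \<ge> 0"
proof -
  have "- form (-1) d x y \<ge> 1" using hyp_form_le assms by (fastforce simp: hyp_eq_space_pts)
  then show "cosh (hdist d x y) = - form (-1) d x y" "hdist d x y \<ge> 0"
    by (simp_all add: hdist_def lor_eq_form cosh_arcosh_real arcosh_nonneg_real)
qed

lemma hdist_eqI:
  assumes "form (-1) d x y = - cosh r" "r \<ge> 0"
  shows "hdist d x y = r"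
  using assms by (simp add: hdist_def lor_eq_form arcosh_cosh_real)

lemma sph_form_bounds:
  assumes "x \<in> sph d" "y \<in> sph d"
  shows "form 1 d x y \<le> 1" "form 1 d x y \<ge> -1"
proof -
  interpret space_form 1 d by unfold_locales auto
  have "(B x y)\<^sup>2 \<le> 1" using assms pf_self[of x y] pf_nonneg[of y x] by (simp add: sph_eq_space_pts)
  then show "form 1 d x y \<le> 1" "form 1 d x y \<ge> -1" by (auto simp: abs_square_le_1 abs_le_iff)
qed

lemma sdist_props:
  assumes "x \<in> sph d" "y \<in> sph d"
  shows "cos (sdist d x y) = form 1 d x y" "sdist d x y \<ge> 0" "sdist d x y \<le> pi"
  using sph_form_bounds[OF assms]
  by (simp_all add: sdist_def eucl_eq_form arccos_lbound arccos_ubound)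

lemma sdist_eqI:
  assumes "form 1 d x y = cos r" "r \<ge> 0" "r \<le> pi"
  shows "sdist d x y = r"
  using assms by (simp add: sdist_def eucl_eq_form arccos_cos)

text \<open>At \<open>z\<close> the projections of \<open>x\<close> and \<open>y\<close> have
  lengths \<open>sinh a\<close> and \<open>sinh b\<close>. By the addition formula for
  \<open>cosh\<close>, additivity of the distances says exactly that they are antiparallel.\<close>

lemma geodesic_hdist: "geodesic_dist (-1) d (hdist d)"
  unfolding geodesic_dist_def
proof (intro conjI ballI allI impI)
  interpret space_form "-1" d by unfold_locales auto
  fix x y z assume M: "x \<in> M" "y \<in> M" "z \<in> M"
  note H = hyp_eq_space_pts[symmetric]
  define a b where "a = hdist d x z" and "b = hdist d z y"
  have ab: "cosh a = - B x z" "cosh b = - B z y" "a \<ge> 0" "b \<ge> 0"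
    unfolding a_def b_def using M hdist_props by (auto simp: H)
  have xx: "pf z x x = (sinh a)\<^sup>2" and yy: "pf z y y = (sinh b)\<^sup>2"
  proof -
    have "B x z = - cosh a" "B y z = - cosh b" using ab form_sym[of "-1" d y z] by auto
    then show "pf z x x = (sinh a)\<^sup>2" "pf z y y = (sinh b)\<^sup>2" using M by (simp_all add: pf_self cosh_square_eq)
  qed
  have xy: "pf z x y = B x y + cosh a * cosh b"
    using ab by (simp add: pf_def form_sym[of _ _ y z])
  {
    assume "hdist d x z + hdist d z y = hdist d x y"
    then have "cosh (a + b) = - B x y" using M hdist_props(1)[of x d y] by (simp add: H a_def b_def)
    then have xy': "pf z x y = - (sinh a * sinh b)" using xy by (simp add: cosh_add)
    \<comment> \<open>The coefficients balance the two antiparallel projections, so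
      \<open>?N\<close> is a multiple of \<open>z\<close>; the factor is
      \<open>sinh (a + b)\<close>.\<close>
    let ?N = "comb (sinh b) x (sinh a) y"
    have "pf z ?N ?N = 0"
      using xx yy xy' by (simp add: pf_comb_left pf_comb_right pf_sym[of z y x] power2_eq_square algebra_simps)
    then have N: "?N i = - B ?N z * z i" if "i \<le> d" for i using pf_eq_0D[OF M(3) _ that] by simp
    have Nz: "- B ?N z = sinh (a + b)" using ab by (simp add: form_comb_left sinh_add form_sym[of _ _ y z])
    show "(\<exists>a b. a \<ge> 0 \<and> b \<ge> 0 \<and> z = comb a x b y) \<or> y = comb (-1) x 0 x"
    proof (cases "a + b > 0")
      case True
      then have s: "sinh (a + b) > 0" by simp
      have "z = comb (sinh b / sinh (a + b)) x (sinh a / sinh (a + b)) y"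
      proof (rule ambient_eqI)
        fix i assume "i \<le> d"
        then show "z i = comb (sinh b / sinh (a + b)) x (sinh a / sinh (a + b)) y i"
          using N[of i] s unfolding Nz by (simp add: comb_def field_simps)
      qed (use M in \<open>auto intro: ambient_comb space_ptsD\<close>)
      then show ?thesis using s ab by (metis divide_nonneg_pos sinh_real_nonneg_iff)
    next
      case False
      then have a0: "a = 0" using ab by simp
      then have "pf z x x = 0" using xx by simp
      from pf_eq_0D[OF M(3) this] have "z = x"
        using ab(1) a0 M by (intro ambient_eqI) (auto dest: space_ptsD)
      then have "z = comb 1 x 0 y" by (simp add: comb_def)
      then show ?thesis by (metis zero_le_one order_refl)
    qed
  next
    fix \<alpha> \<beta> :: real assume ge: "\<alpha> \<ge> 0" "\<beta> \<ge> 0" and eq: "z = comb \<alpha> x \<beta> y"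
    have self: "hdist d w w = 0" if "w \<in> M" for w
      using space_ptsD(2)[OF that] by (intro hdist_eqI) auto
    consider "\<beta> = 0" | "\<alpha> = 0" | "\<alpha> > 0" "\<beta> > 0" using ge by linarith
    then show "hdist d x z + hdist d z y = hdist d x y"
    proof cases
      case 1
      then have "z = x" using scaled_point_eq[OF M(1,3) ge(1)] eq by simp
      then show ?thesis using self M by simp
    next
      case 2
      then have "z = comb \<beta> y 0 x" using eq by (simp add: comb_def add.commute)
      then have "z = y" using scaled_point_eq[OF M(2,3) ge(2)] by simp
      then show ?thesis using self M by simp
    next
      case 3
      then have "pf z x y = - (sinh a * sinh b)" using pf_between(1)[OF M(3) 3 eq] xx yy ab by simp
      then have "B x y = - cosh (a + b)" using xy by (simp add: cosh_add)
      then show ?thesis using hdist_eqI[of d x y "a + b"] ab by (simp add: a_def b_def)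
    qed
  }
qed

text \<open>The hyperbolic argument with circular functions, complicated by the range of
  \<open>arccos\<close>: distances adding up to \<open>pi\<close> lead to the antipodal alternative,
  and the converse has to show \<open>a + b \<le> pi\<close> before the angle can be recovered from
  its cosine.\<close>

lemma geodesic_sdist: "geodesic_dist 1 d (sdist d)"
  unfolding geodesic_dist_def
proof (intro conjI ballI allI impI)
  interpret space_form 1 d by unfold_locales auto
  fix x y z assume M: "x \<in> M" "y \<in> M" "z \<in> M"
  note H = sph_eq_space_pts[symmetric]
  define a b where "a = sdist d x z" and "b = sdist d z y"
  have ab: "cos a = B x z" "cos b = B z y" "a \<ge> 0" "b \<ge> 0" "a \<le> pi" "b \<le> pi"
    unfolding a_def b_def using M sdist_props by (auto simp: H)
  then have s0: "sin a \<ge> 0" "sin b \<ge> 0" by (auto intro: sin_ge_zero)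
  have xx: "pf z x x = (sin a)\<^sup>2" and yy: "pf z y y = (sin b)\<^sup>2"
  proof -
    have "B x z = cos a" "B y z = cos b" using ab form_sym[of 1 d y z] by auto
    then show "pf z x x = (sin a)\<^sup>2" "pf z y y = (sin b)\<^sup>2" using M by (simp_all add: pf_self sin_squared_eq)
  qed
  have xy: "pf z x y = B x y - cos a * cos b"
    using ab by (simp add: pf_def form_sym[of _ _ y z])
  {
    assume eq: "sdist d x z + sdist d z y = sdist d x y"
    then have cab: "cos (a + b) = B x y" and le: "a + b \<le> pi"
      using M sdist_props[of x d y] by (auto simp: H a_def b_def)
    then have xy': "pf z x y = - (sin a * sin b)" using xy by (simp add: cos_add)
    let ?N = "comb (sin b) x (sin a) y"
    have "pf z ?N ?N = 0"
      using xx yy xy' by (simp add: pf_comb_left pf_comb_right pf_sym[of z y x] power2_eq_square algebra_simps)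
    then have N: "?N i = B ?N z * z i" if "i \<le> d" for i using pf_eq_0D[OF M(3) _ that] by simp
    have Nz: "B ?N z = sin (a + b)" using ab by (simp add: form_comb_left sin_add form_sym[of _ _ y z])
    consider "a + b = 0" | "a + b = pi" | "0 < a + b" "a + b < pi" using ab le by linarith
    then show "(\<exists>a b. a \<ge> 0 \<and> b \<ge> 0 \<and> z = comb a x b y) \<or> y = comb (-1) x 0 x"
    proof cases
      case 3
      then have s: "sin (a + b) > 0" by (rule sin_gt_zero)
      have "z = comb (sin b / sin (a + b)) x (sin a / sin (a + b)) y"
      proof (rule ambient_eqI)
        fix i assume "i \<le> d"
        then show "z i = comb (sin b / sin (a + b)) x (sin a / sin (a + b)) y i"
          using N[of i] s unfolding Nz by (simp add: comb_def field_simps)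
      qed (use M in \<open>auto intro: ambient_comb space_ptsD\<close>)
      then show ?thesis using s s0 by (metis divide_nonneg_pos)
    next
      case 1
      then have a0: "a = 0" using ab by simp
      then have "pf z x x = 0" using xx by simp
      from pf_eq_0D[OF M(3) this] have "z = x"
        using ab(1) a0 M by (intro ambient_eqI) (auto dest: space_ptsD)
      then have "z = comb 1 x 0 y" by (simp add: comb_def)
      then show ?thesis by (metis zero_le_one order_refl)
    next
      case 2
      then have 1: "B x y = -1" using cab by simp
      then have "pf x y y = 0" using M by (simp add: pf_self form_sym[of _ _ y x])
      note y = pf_eq_0D[OF M(1) this]
      have "comb (-1) x 0 x \<in> ambient d" using M by (intro ambient_comb) (auto dest: space_ptsD)
      then have "y = comb (-1) x 0 x"
        using y 1 M form_sym[of 1 d y x] by (intro ambient_eqI) (auto dest: space_ptsD simp: comb_def)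
      then show ?thesis by simp
    qed
  next
    fix \<alpha> \<beta> :: real assume ge: "\<alpha> \<ge> 0" "\<beta> \<ge> 0" and eq: "z = comb \<alpha> x \<beta> y"
    have self: "sdist d w w = 0" if "w \<in> M" for w
      using space_ptsD(2)[OF that] by (intro sdist_eqI) auto
    consider "\<beta> = 0" | "\<alpha> = 0" | "\<alpha> > 0" "\<beta> > 0" using ge by linarith
    then show "sdist d x z + sdist d z y = sdist d x y"
    proof cases
      case 1
      then have "z = x" using scaled_point_eq[OF M(1,3) ge(1)] eq by simp
      then show ?thesis using self M by simp
    next
      case 2
      then have "z = comb \<beta> y 0 x" using eq by (simp add: comb_def add.commute)
      then have "z = y" using scaled_point_eq[OF M(2,3) ge(2)] by simp
      then show ?thesis using self M by simp
    next
      case 3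
      note btw = pf_between[OF M(3) 3 eq]
      have "pf z x y = - (sin a * sin b)" and ss: "\<alpha> * sin a = \<beta> * sin b"
        using btw xx yy s0 by auto
      then have "B x y = cos (a + b)" using xy by (simp add: cos_add)
      \<comment> \<open>The two relations for the coefficients give
        \<open>\<alpha> * sin (a + b) = sin b\<close>, hence a non-negative sine. Beyond
        \<open>pi\<close> this leaves only \<open>a = b = pi\<close>, where
        \<open>\<alpha> * cos a + \<beta> * cos b\<close> would be negative instead of one.\<close>
      moreover have "a + b \<le> pi"
      proof (rule ccontr)
        assume gt: "\<not> a + b \<le> pi"
        have "B z z = \<alpha> * B x z + \<beta> * B y z" by (subst (1) eq) (simp add: form_comb_left)
        then have one: "\<alpha> * cos a + \<beta> * cos b = 1" using ab space_ptsD[OF M(3)] form_sym[of _ _ y z] by simp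
        have "\<alpha> * sin (a + b) = (\<alpha> * sin a) * cos b + (\<alpha> * cos a) * sin b"
          by (simp add: sin_add algebra_simps)
        also have "\<alpha> * cos a = 1 - \<beta> * cos b" using one by simp
        finally have "\<alpha> * sin (a + b) = sin b" using ss by (simp add: algebra_simps)
        then have "sin (a + b) \<ge> 0" using 3 s0 by (metis zero_le_mult_iff not_le)
        then have "a + b = 2 * pi" using sin_lt_zero[of "a + b"] gt ab by fastforce
        then have "a = pi" "b = pi" using ab by auto
        then show False using one 3 by simp
      qed
      ultimately show ?thesis using sdist_eqI[of d x y "a + b"] ab by (simp add: a_def b_def)
    qed
  }
qed

section \<open>The hull of the vertices as a cone\<close>

context simplex
begin

definition T where "T = {z \<in> M. \<forall>j\<le>d. B (g j) z \<ge> 0}"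

text \<open>Non-negative combinations keep the coordinates non-negative. An antipodal pair cannot
  lie in \<open>T\<close>, since all its coordinates would vanish.\<close>

lemma gconvex_T:
  assumes "geodesic_dist e d \<delta>"
  shows "gconvex M \<delta> T"
  unfolding gconvex_def
proof (intro conjI ballI impI)
  show "T \<subseteq> M" by (auto simp: T_def)
  fix x y z assume xy: "x \<in> T" "y \<in> T" and z: "z \<in> M" and eq: "\<delta> x z + \<delta> z y = \<delta> x y"
  have M: "x \<in> M" "y \<in> M" using xy by (auto simp: T_def)
  have "y \<noteq> comb (-1) x 0 x"
  proof
    assume y: "y = comb (-1) x 0 x"
    have "B (g j) x = 0" if "j \<le> d" for j
    proof -
      have "B (g j) y \<ge> 0" "B (g j) x \<ge> 0" using xy that by (auto simp: T_def)
      then show ?thesis unfolding y by (simp add: form_comb_right)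
    qed
    then show False using expand_form_self[OF M(1)] sign by auto
  qed
  then obtain a b where "a \<ge> 0" "b \<ge> 0" "z = comb a x b y"
    using assms M z eq unfolding geodesic_dist_def by blast
  then show "z \<in> T" using xy z by (auto simp: T_def form_comb_right)
qed

lemma v_in_T: "v ` {..d} \<subseteq> T"
  by (auto simp: T_def v_in dual)

text \<open>Allows a non-trivial cone combination to be normalised to a point of \<open>M\<close>.
  On the sphere it is nonzero because its coordinate at \<open>k\<close> is \<open>c k\<close>; in
  the hyperbolic case any two vertices have product at most \<open>-1\<close>.\<close>

lemma cone_form_pos:
  assumes J: "J \<subseteq> {..d}" and c: "\<And>j. j \<in> J \<Longrightarrow> c j \<ge> 0" and k: "k \<in> J" "c k > 0"
    and y: "y = (\<lambda>i. \<Sum>j\<in>J. c j * v j i)"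
  shows "e * B y y > 0" "e = -1 \<Longrightarrow> y 0 > 0"
proof -
  have fin: "finite J" using J finite_subset by blast
  have Byx: "B y x = (\<Sum>j\<in>J. c j * B (v j) x)" for x unfolding y by (rule form_sum_left)
  show "e * B y y > 0"
  proof (cases "e = 1")
    case True
    have amb: "y \<in> ambient d" unfolding y using J v_in by (intro ambient_sum) (auto dest: space_ptsD)
    have "B (g k) y = c k"
    proof -
      have "B (g k) y = (\<Sum>j\<in>J. c j * (if k = j then 1 else 0))"
        unfolding form_sym[of e d "g k"] Byx using J k dual
        by (intro sum.cong) (auto simp: form_sym[of e d _ "g k"] subset_iff)
      then show ?thesis using fin k by (simp add: sum.delta' if_distrib cong: if_cong)
    qed
    moreover have "B (g k) y = 0" if "B y y = 0"
    proof -
      have "(\<Sum>i\<le>d. y i * y i) = 0" using that True by (simp add: form_def)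
      then have "\<forall>i\<le>d. y i = 0" by (subst (asm) sum_nonneg_eq_0_iff) auto
      then show ?thesis by (simp add: form_def)
    qed
    moreover have "B y y \<ge> 0" using True by (auto simp: form_def intro: sum_nonneg)
    ultimately show ?thesis using True k by fastforce
  next
    case False
    then have e: "e = -1" using sign by simp
    have neg: "c j * B (v j) (v i) \<le> - c j" if "i \<in> J" "j \<in> J" for i j
    proof -
      have "B (v j) (v i) \<le> -1" using hyp_form_le that J v_in e by blast
      then show ?thesis using mult_left_mono[OF _ c[OF that(2)]] by fastforce
    qed
    have "B y (v i) \<le> - c k" if "i \<in> J" for i
    proof -
      have "B y (v i) \<le> (\<Sum>j\<in>J. - c j)" unfolding Byx using neg that by (intro sum_mono) auto
      also have "\<dots> \<le> - c k" using member_le_sum[of k J c] k c fin by (simp add: sum_negf)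
      finally show ?thesis .
    qed
    then have "B (v i) y \<le> - c k" if "i \<in> J" for i using that form_sym by metis
    then have "B y y \<le> (\<Sum>j\<in>J. c j * - c k)" unfolding Byx[of y] using c by (intro sum_mono mult_left_mono) auto
    also have "\<dots> = - (c k * (\<Sum>j\<in>J. c j))" by (simp add: sum_negf mult.commute flip: sum_distrib_right)
    also have "\<dots> < 0" using member_le_sum[of k J c] k c fin by (simp add: less_le_trans)
    finally show ?thesis using e by simp
  qed
  assume e: "e = -1"
  then have v0: "v j 0 > 0" if "j \<in> J" for j using v_in[of j] that J by (auto dest: space_ptsD)
  show "y 0 > 0" unfolding y
    using c v0 k fin by (intro sum_pos2[of _ k]) (auto intro: mult_nonneg_nonneg less_imp_le[OF v0])
qed

text \<open>For the harder inclusion, induct on the number of vertices used: split off one vertex,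
  normalise the rest to a point \<open>w\<close>, which is in the convex set by induction, and note
  that \<open>z\<close> lies between that vertex and \<open>w\<close>.\<close>

lemma ghull_eq:
  assumes \<delta>: "geodesic_dist e d \<delta>"
  shows "ghull M \<delta> (v ` {..d}) = T"
proof
  show "ghull M \<delta> (v ` {..d}) \<subseteq> T"
    using gconvex_T[OF \<delta>] v_in_T by (auto simp: ghull_def)
  have *: "z \<in> A" if A: "gconvex M \<delta> A" "v ` {..d} \<subseteq> A" and z: "z \<in> M" "z = (\<lambda>i. \<Sum>j\<in>J. c j * v j i)"
    and c: "\<And>j. j \<in> J \<Longrightarrow> c j \<ge> 0" and J: "J \<subseteq> {..d}" for A J c z
  proof -
    have "finite J" using J finite_subset by blast
    then show ?thesis using z c J
    proof (induction J arbitrary: z c rule: finite_induct)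
      case empty
      then have "B z z = 0" by (simp add: form_def)
      then show ?case using space_ptsD[OF empty(1)] sign by auto
    next
      case (insert k J)
      define y where "y = (\<lambda>i. \<Sum>j\<in>J. c j * v j i)"
      have kd: "k \<le> d" and Jd: "J \<subseteq> {..d}" using insert by auto
      have zy: "z = comb (c k) (v k) 1 y"
        unfolding insert.prems(2) y_def comb_def using insert.hyps by simp
      have vk: "v k \<in> A" using A kd by auto
      show ?case
      proof (cases "\<exists>i\<in>J. c i > 0")
        case False
        then have "y i = 0" for i unfolding y_def using insert.prems(3) by (intro sum.neutral) (auto simp: less_le)
        then have "z = comb (c k) (v k) 0 y" unfolding zy by (simp add: comb_def)
        from scaled_point_eq[OF v_in[OF kd] insert.prems(1) _ this] have "z = v k"
          using insert.prems(3)[of k] by blast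
        then show ?thesis using vk by simp
      next
        case True
        then obtain i where i: "i \<in> J" "c i > 0" by blast
        note pos = cone_form_pos[OF Jd _ i y_def]
        define n where "n = sqrt (e * B y y)"
        define w where "w = comb (1 / n) y 0 y"
        have npos: "n > 0" using pos(1) insert.prems(3) by (simp add: n_def)
        have amb: "y \<in> ambient d" unfolding y_def using Jd v_in by (intro ambient_sum) (auto dest: space_ptsD)
        have w: "w \<in> M" unfolding w_def n_def using pos insert.prems(3) by (intro normalize_in amb) auto
        have "w = (\<lambda>i. \<Sum>j\<in>J. c j / n * v j i)" unfolding w_def y_def comb_def
          by (simp add: sum_divide_distrib)
        from insert.IH[OF w this _ Jd] have "w \<in> A" using npos insert.prems(3) by simp
        have "z = comb (c k) (v k) n w" unfolding zy w_def using npos by (simp add: comb_def)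
        then have "\<delta> (v k) z + \<delta> z w = \<delta> (v k) w"
          using \<delta> v_in[OF kd] w insert.prems(1,3) npos unfolding geodesic_dist_def by (simp add: less_imp_le)
        then show ?thesis using A(1) vk \<open>w \<in> A\<close> insert.prems(1) unfolding gconvex_def by blast
      qed
    qed
  qed
  show "T \<subseteq> ghull M \<delta> (v ` {..d})"
  proof
    fix z assume z: "z \<in> T"
    then have zM: "z \<in> M" by (simp add: T_def)
    have "z = (\<lambda>i. \<Sum>j\<le>d. B (g j) z * v j i)"
      using zM v_in expand by (intro ambient_eqI ambient_sum) (auto dest: space_ptsD)
    then have "z \<in> A" if "gconvex M \<delta> A" "v ` {..d} \<subseteq> A" for A
      using z by (intro *[OF that zM, of _ "{..d}"]) (auto simp: T_def)
    then show "z \<in> ghull M \<delta> (v ` {..d})" by (auto simp: ghull_def)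
  qed
qed

end

section \<open>Compactness and the centre of a regular simplex\<close>

text \<open>Bolzano-Weierstrass one coordinate at a time: each new coordinate is made monotone along
  a further subsequence.\<close>

lemma bounded_coordinates_subseq:
  fixes X :: "nat \<Rightarrow> nat \<Rightarrow> real"
  assumes "\<And>n i. i < m \<Longrightarrow> \<bar>X n i\<bar> \<le> K"
  shows "\<exists>\<phi> L. strict_mono \<phi> \<and> (\<forall>i<m. (\<lambda>n. X (\<phi> n) i) \<longlonglongrightarrow> L i)"
  using assms
proof (induction m)
  case 0
  show ?case by (auto intro: exI[of _ id] strict_mono_id)
next
  case (Suc m)
  then obtain \<phi> L where \<phi>: "strict_mono \<phi>" and L: "\<And>i. i < m \<Longrightarrow> (\<lambda>n. X (\<phi> n) i) \<longlonglongrightarrow> L i"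
    by (metis less_SucI)
  obtain f where f: "strict_mono f" "monoseq (\<lambda>n. X (\<phi> (f n)) m)"
    using seq_monosub[of "\<lambda>n. X (\<phi> n) m"] by auto
  have "Bseq (\<lambda>n. X (\<phi> (f n)) m)" using Suc.prems by (intro BseqI'[of _ K]) simp
  then obtain l where l: "(\<lambda>n. X (\<phi> (f n)) m) \<longlonglongrightarrow> l"
    using Bseq_monoseq_convergent f(2) unfolding convergent_def by blast
  have "(\<lambda>n. X ((\<phi> \<circ> f) n) i) \<longlonglongrightarrow> (L(m := l)) i" if "i < Suc m" for i
    using l LIMSEQ_subseq_LIMSEQ[OF L f(1)] that by (auto simp: less_Suc_eq o_def)
  then show ?case using strict_mono_o[OF \<phi> f(1)] by blast
qed

text \<open>The additional bound by \<open>r\<close> keeps the centres in a bounded region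
  (hyperbolic case) and the radii below \<open>pi\<close> (spherical case).\<close>

lemma seq_to_Inf:
  fixes Y :: "real set"
  assumes r: "r \<in> Y" and bdd: "bdd_below Y"
  shows "\<exists>f. (\<forall>n. f n \<in> Y \<and> f n \<le> r) \<and> f \<longlonglongrightarrow> Inf Y"
proof -
  have "\<exists>s\<in>Y. s \<le> r \<and> s \<le> Inf Y + inverse (real (Suc n))" for n
  proof -
    have "Inf Y < Inf Y + inverse (real (Suc n))" by simp
    then obtain s where "s \<in> Y" "s < Inf Y + inverse (real (Suc n))"
      using cInf_lessD[of Y] r by blast
    then show ?thesis using r by (cases "s \<le> r") (auto intro: less_imp_le)
  qed
  then obtain f where f: "\<And>n. f n \<in> Y \<and> f n \<le> r \<and> f n \<le> Inf Y + inverse (real (Suc n))" by metis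
  have "f \<longlonglongrightarrow> Inf Y"
  proof (rule tendsto_sandwich[OF _ _ tendsto_const])
    show "\<forall>\<^sub>F n in sequentially. Inf Y \<le> f n" using f cInf_lower[OF _ bdd] by simp
    show "\<forall>\<^sub>F n in sequentially. f n \<le> Inf Y + inverse (real (Suc n))" using f by simp
  qed (rule LIMSEQ_inverse_real_of_nat_add)
  then show ?thesis using f by blast
qed

lemma seq_to_Sup:
  fixes X :: "real set"
  assumes r: "r \<in> X" and bdd: "bdd_above X"
  shows "\<exists>f. (\<forall>n. f n \<in> X) \<and> f \<longlonglongrightarrow> Sup X"
proof -
  have "\<exists>s\<in>X. Sup X + - inverse (real (Suc n)) \<le> s" for n
  proof -
    have "Sup X + - inverse (real (Suc n)) < Sup X" by simp
    then obtain s where "s \<in> X" "Sup X + - inverse (real (Suc n)) < s"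
      using less_cSupD[of X] r by blast
    then show ?thesis by (auto intro: less_imp_le)
  qed
  then obtain f where f: "\<And>n. f n \<in> X \<and> Sup X + - inverse (real (Suc n)) \<le> f n" by metis
  have "f \<longlonglongrightarrow> Sup X"
  proof (rule tendsto_sandwich[OF _ _ _ tendsto_const])
    show "\<forall>\<^sub>F n in sequentially. f n \<le> Sup X" using f cSup_upper[OF _ bdd] by simp
    show "\<forall>\<^sub>F n in sequentially. Sup X + - inverse (real (Suc n)) \<le> f n" using f by simp
  qed (rule LIMSEQ_inverse_real_of_nat_add_minus)
  then show ?thesis using f by blast
qed

context space_form
begin

lemma bounded_points_limit:
  fixes X :: "nat \<Rightarrow> nat \<Rightarrow> real"
  assumes X: "\<And>n. X n \<in> M" and bdd: "\<forall>n. \<forall>i\<le>d. \<bar>X n i\<bar> \<le> K"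
  shows "\<exists>\<phi>. \<exists>c\<in>M. strict_mono \<phi> \<and> (\<forall>y. (\<lambda>n. B (X (\<phi> n)) y) \<longlonglongrightarrow> B c y)"
proof -
  obtain \<phi> L where \<phi>: "strict_mono \<phi>" and L: "\<And>i. i < Suc d \<Longrightarrow> (\<lambda>n. X (\<phi> n) i) \<longlonglongrightarrow> L i"
    using bounded_coordinates_subseq[of "Suc d" X K] bdd by (auto simp: less_Suc_eq_le)
  define c where "c = (\<lambda>i. if i \<le> d then L i else 0)"
  have c: "(\<lambda>n. X (\<phi> n) i) \<longlonglongrightarrow> c i" if "i \<le> d" for i using L[of i] that by (simp add: c_def)
  have lim: "(\<lambda>n. B (X (\<phi> n)) y) \<longlonglongrightarrow> B c y" for y
    unfolding form_def by (intro tendsto_intros c) simp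
  have "(\<lambda>n. B (X (\<phi> n)) (X (\<phi> n))) \<longlonglongrightarrow> B c c"
    unfolding form_def by (intro tendsto_intros c) auto
  moreover have "B (X (\<phi> n)) (X (\<phi> n)) = e" for n using X by (auto dest: space_ptsD)
  ultimately have cc: "B c c = e" by (simp add: LIMSEQ_const_iff)
  \<comment> \<open>Positivity of \<open>x 0\<close> is not a closed condition, but a limit with
    \<open>c 0 = 0\<close> would have \<open>B c c \<ge> 0\<close> instead of
    \<open>-1\<close>.\<close>
  have "c 0 > 0" if e: "e = -1"
  proof -
    have "c 0 \<ge> 0" using X e by (intro LIMSEQ_le_const[OF c[of 0]]) (auto dest: space_ptsD intro: less_imp_le)
    moreover have "c 0 \<noteq> 0"
    proof
      assume "c 0 = 0"
      then have "B c c \<ge> 0" by (auto simp: form_split intro: sum_nonneg)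
      then show False using cc e by simp
    qed
    ultimately show ?thesis by simp
  qed
  then have "c \<in> M" using cc by (auto simp: space_pts_def ambient_def c_def)
  then show ?thesis using \<phi> lim by blast
qed

lemma tendsto_pf:
  assumes "\<And>y. (\<lambda>n. B (X n) y) \<longlonglongrightarrow> B c y"
  shows "(\<lambda>n. pf (X n) x y) \<longlonglongrightarrow> pf c x y"
  unfolding pf_def form_sym[of e d _ "X _"] form_sym[of e d _ c] by (intro tendsto_intros assms)

end

context simplex
begin

text \<open>Product \<open>e\<close> with \<open>p\<close> means distance zero, so all vertices
  would equal \<open>p\<close>, while \<open>g 0\<close> separates \<open>v 0\<close> from
  \<open>v 1\<close>. This excludes outer radius zero.\<close>

lemma vertices_not_concentrated:
  assumes p: "p \<in> M"
  shows "\<exists>j\<le>d. e * B p (v j) \<noteq> 1"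
proof (rule ccontr)
  assume "\<not> ?thesis"
  then have 1: "e * B p (v j) = 1" if "j \<le> d" for j using that by blast
  have eq: "v j i = p i" if "j \<le> d" "i \<le> d" for i j
  proof -
    have "(B (v j) p)\<^sup>2 = 1" using 1[OF that(1)] sign by (auto simp: form_sym[of e d p] minus_equation_iff)
    then have "pf p (v j) (v j) = 0" using pf_self[OF v_in[OF that(1)], of p] by simp
    from pf_eq_0D[OF p this that(2)] show ?thesis using 1[OF that(1)] by (simp add: form_sym[of e d p])
  qed
  have "B (g 0) (v 0) = B (g 0) (v 1)" using eq dim_pos by (intro form_cong) auto
  then show False using dual[of 0 0] dual[of 0 1] dim_pos by simp
qed

text \<open>Tests the ball at its boundary point closest to facet \<open>j\<close>: that its
  coordinate is non-negative is the claim.\<close>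

lemma in_ball_dual:
  assumes c: "c \<in> M" and ks: "e * k\<^sup>2 + s\<^sup>2 = e" and j: "j \<le> d" and cT: "c \<in> T" and k: "k \<ge> 0"
    and ball: "\<And>x. x \<in> ambient d \<Longrightarrow> B x x = e \<Longrightarrow> B c x = e * k \<Longrightarrow> x \<in> T"
  shows "s * sqrt (pf c (g j) (g j)) \<le> k * B (g j) c"
proof (cases "pf c (g j) (g j) = 0")
  case True
  then show ?thesis using cT j k by (simp add: T_def)
next
  case False
  then have "pf c (g j) (g j) > 0" using pf_nonneg[OF c, of "g j"] by simp
  from geodesic_point[OF c this ks g_ambient[OF j]]
  obtain x where "x \<in> ambient d" "B x x = e" "B c x = e * k"
    "B (g j) x = k * B (g j) c - s * sqrt (pf c (g j) (g j))" by blast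
  moreover from this ball have "x \<in> T" by blast
  then have "0 \<le> B (g j) x" using j unfolding T_def by blast
  ultimately show ?thesis by simp
qed

text \<open>By symmetry the centre is the normalised sum \<open>E\<close> of the vertices, and every
  product in question is a function of \<open>b\<close> and \<open>d\<close>. The final identity is
  the tight case of the estimate for the trace.\<close>

lemma regular_centre:
  assumes const: "\<forall>i\<le>d. \<forall>j\<le>d. i \<noteq> j \<longrightarrow> B (v i) (v j) = b"
  shows "\<exists>c\<in>M. \<exists>(a::real) (\<gamma>::real). a > 0 \<and> \<gamma> > 0 \<and> e * (1 - a\<^sup>2) > 0 \<and> (\<forall>j\<le>d. e * B (v j) c = a \<and> B (g j) c = \<gamma> \<and>
    sqrt (pf c (g j) (g j)) * sqrt (e * (1 - a\<^sup>2)) = d * (a * \<gamma>))"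
proof -
  have b: "B (v i) (v j) = b" if "i \<le> d" "j \<le> d" "i \<noteq> j" for i j using const that by blast
  define E where "E = (\<lambda>i. \<Sum>j\<le>d. 1 * v j i)"
  define m where "m = e + d * b"
  have e0: "e \<noteq> 0" using sign by auto
  have d0: "real d > 0" using dim_pos by simp
  have vv: "B (v j) (v j) = e" if "j \<le> d" for j using v_in[OF that] by (rule space_ptsD)
  have vE: "B E x = (\<Sum>j\<le>d. B (v j) x)" for x
    unfolding E_def by (subst form_sum_left) simp
  have Ev: "B E (v j) = m" if "j \<le> d" for j
  proof -
    have "B E (v j) = B (v j) (v j) + (\<Sum>i\<in>{..d} - {j}. B (v i) (v j))"
      unfolding vE using that by (intro sum.remove) auto
    also have "(\<Sum>i\<in>{..d} - {j}. B (v i) (v j)) = (\<Sum>i\<in>{..d} - {j}. b)"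
      using b that by (intro sum.cong) auto
    finally show ?thesis using that by (simp add: vv m_def)
  qed
  have EE: "B E E = (d + 1) * m"
    unfolding vE[of E] using Ev by (simp add: form_sym[of e d _ E])
  have Eg: "B E (g j) = 1" if "j \<le> d" for j
    unfolding vE using dual that by (simp add: form_sym[of e d _ "g j"] sum.delta')
  have pos: "e * B E E > 0" "e = -1 \<Longrightarrow> E 0 > 0"
    using cone_form_pos[OF order_refl _ _ _ E_def, of 0] by auto
  then have "(d + 1) * (e * m) > 0" unfolding EE by (simp add: mult_ac)
  then have em: "e * m > 0" by (rule zero_less_mult_pos) simp
  then have m0: "m \<noteq> 0" by auto
  have Eamb: "E \<in> ambient d" unfolding E_def using v_in by (intro ambient_sum) (auto dest: space_ptsD)
  \<comment> \<open>\<open>b = e\<close> would put every vertex at distance zero from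
    \<open>v 0\<close>.\<close>
  have be: "e - b \<noteq> 0"
  proof
    assume "e - b = 0"
    then have "e * B (v 0) (v j) = 1" if "j \<le> d" for j
      using b[of 0 j] vv[of j] e_sq that by (cases "j = 0") auto
    then show False using vertices_not_concentrated[OF v_in[of 0]] by auto
  qed
  define n where "n = sqrt (e * B E E)"
  have n: "n > 0" and nn: "n * n = (d + 1) * (e * m)" using pos(1) EE by (auto simp: n_def)
  define c where "c = comb (1 / n) E 0 E"
  have c: "c \<in> M" unfolding c_def n_def using pos by (intro normalize_in Eamb)
  define a where "a = e * m / n"
  define \<gamma> where "\<gamma> = 1 / n"
  have va: "B (v j) c = m / n" if "j \<le> d" for j
    using Ev[OF that] by (simp add: c_def form_comb_right form_sym[of e d _ E])
  have g\<gamma>: "B (g j) c = \<gamma>" if "j \<le> d" for j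
    using Eg[OF that] by (simp add: c_def \<gamma>_def form_comb_right form_sym[of e d _ E])
  have a\<gamma>: "a * \<gamma> = 1 / (d + 1)"
  proof -
    have "a * \<gamma> = e * m / (n * n)" by (simp add: a_def \<gamma>_def)
    then show ?thesis unfolding nn using e0 m0 by simp
  qed
  have a2: "e * (1 - a\<^sup>2) = d * (e - b) / (d + 1)"
  proof -
    have "a\<^sup>2 = (e * m) * (e * m) / (n * n)" by (simp add: a_def power2_eq_square)
    also have "\<dots> = e * m / (d + 1)" unfolding nn using e0 m0 by simp
    finally have "e * (1 - a\<^sup>2) = e - (e * e) * m / (d + 1)" by (simp add: algebra_simps)
    also have "\<dots> = d * (e - b) / (d + 1)" unfolding e_sq m_def by (simp add: field_simps)
    finally show ?thesis .
  qed
  have G: "pf c (g j) (g j) = d / ((d + 1) * (e - b))" if j: "j \<le> d" for j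
  proof -
    \<comment> \<open>The solution of the linear system making \<open>h\<close> a combination of
      \<open>v j\<close> and \<open>E\<close> with the products that define \<open>g j\<close>; it
      yields \<open>B (g j) (g j)\<close>.\<close>
    define x where "x = 1 / (e - b)"
    define y where "y = - (b * x) / m"
    define h where "h = comb x (v j) y E"
    have hv: "B (v i) h = (if i = j then 1 else 0)" if "i \<le> d" for i
    proof -
      have "B (v i) h = x * B (v i) (v j) + y * m"
        using Ev[OF that] by (simp add: h_def form_comb_right form_sym[of e d _ E])
      also have "y * m = - (b * x)" using m0 by (simp add: y_def)
      finally have *: "B (v i) h = x * (B (v i) (v j) - b)" by (simp add: algebra_simps)
      show ?thesis
      proof (cases "i = j")
        case True
        then show ?thesis using * vv[OF j] be by (simp add: x_def)
      next
        case False
        then show ?thesis using * b[OF that j] by simp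
      qed
    qed
    have "B (g j) (g j) = (\<Sum>i\<le>d. B (g i) (g j) * (if i = j then 1 else 0))"
      using j by (simp add: if_distrib sum.delta cong: if_cong)
    also have "\<dots> = B (g j) h" unfolding expand_form[OF g_ambient[OF j], of h] using hv by simp
    also have "\<dots> = x + y" using Eg[OF j] dual[OF j j] by (simp add: h_def form_comb_right form_sym[of e d "g j" E])
    finally have "pf c (g j) (g j) = x + y - e * (1 / (n * n))" by (simp add: pf_def g\<gamma>[OF j] \<gamma>_def)
    also have "e * (1 / (n * n)) = 1 / ((d + 1) * m)" unfolding nn using e0 by simp
    also have "x + y = x * ((m - b) / m)" using m0 by (simp add: y_def field_simps)
    also have "x * ((m - b) / m) - 1 / ((d + 1) * m) = (m - b) / ((e - b) * m) - 1 / ((d + 1) * m)"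
      by (simp add: x_def)
    also have "\<dots> = ((m - b) * (d + 1) - (e - b)) / ((e - b) * m * (d + 1))"
      using m0 be by (simp add: divide_simps)
    also have "(m - b) * (d + 1) - (e - b) = d * m" by (simp add: m_def algebra_simps)
    also have "d * m / ((e - b) * m * (d + 1)) = d / ((d + 1) * (e - b))" using m0 by simp
    finally show ?thesis .
  qed
  have prod: "pf c (g j) (g j) * (e * (1 - a\<^sup>2)) = (d * (a * \<gamma>))\<^sup>2" if "j \<le> d" for j
    unfolding G[OF that] a2 a\<gamma> using be by (simp add: power2_eq_square)
  have a0: "a > 0" and \<gamma>0: "\<gamma> > 0" using em n by (auto simp: a_def \<gamma>_def)
  \<comment> \<open>The sign of \<open>e - b\<close> is not computed; it is forced by the positive
    product with the non-negative \<open>pf c (g 0) (g 0)\<close>.\<close>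
  have vpos: "e * (1 - a\<^sup>2) > 0"
  proof -
    have "(d * (a * \<gamma>))\<^sup>2 > 0" using a0 \<gamma>0 d0 by simp
    then have "0 < pf c (g 0) (g 0) * (e * (1 - a\<^sup>2))" using prod[of 0] by simp
    then show ?thesis using pf_nonneg[OF c, of "g 0"] by (simp add: zero_less_mult_iff)
  qed
  have "sqrt (pf c (g j) (g j)) * sqrt (e * (1 - a\<^sup>2)) = d * (a * \<gamma>)" if "j \<le> d" for j
    unfolding real_sqrt_mult[symmetric] prod[OF that] using a0 \<gamma>0 by simp
  then have "\<forall>j\<le>d. e * B (v j) c = a \<and> B (g j) c = \<gamma> \<and>
    sqrt (pf c (g j) (g j)) * sqrt (e * (1 - a\<^sup>2)) = d * (a * \<gamma>)"
    using va g\<gamma> by (auto simp: a_def)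
  then show ?thesis using c a0 \<gamma>0 vpos by blast
qed

end

text \<open>With \<open>w\<close> the spatial norm of \<open>y\<close>, the bound on the distance
  gives \<open>x 0 * (y 0 - w) \<le> C\<close>, and the inverse of \<open>y 0 - w\<close> is
  \<open>y 0 + w\<close>, at most \<open>2 * y 0\<close>.\<close>

lemma hyp_point_bound:
  assumes x: "x \<in> space_pts (-1) d" and y: "y \<in> space_pts (-1) d" and le: "- form (-1) d x y \<le> C" and i: "i \<le> d"
  shows "\<bar>x i\<bar> \<le> 2 * C * y 0"
proof -
  let ?s = "\<lambda>x y. (\<Sum>i=1..d. x i * y i :: real)"
  have x0: "x 0 > 0" "?s x x = x 0 * x 0 - 1" and y0: "y 0 > 0" "?s y y = y 0 * y 0 - 1"
    using space_ptsD[OF x] space_ptsD[OF y] by (auto simp: form_split)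
  have yy: "y 0 * y 0 - 1 \<ge> 0" unfolding y0(2)[symmetric] by (intro sum_nonneg) auto
  define w where "w = sqrt (y 0 * y 0 - 1)"
  have w: "w \<ge> 0" "w * w = y 0 * y 0 - 1" using yy by (auto simp: w_def)
  have wy: "w \<le> y 0" by (rule power2_le_imp_le) (use w y0 in \<open>auto simp: power2_eq_square\<close>)
  have "(?s x y)\<^sup>2 \<le> (x 0 * x 0 - 1) * (w * w)"
    using sum_Cauchy_Schwarz[of x y "{1..d}"] unfolding x0(2) y0(2) w(2) .
  also have "\<dots> \<le> (x 0 * w)\<^sup>2" by (simp add: power2_eq_square algebra_simps)
  finally have "?s x y \<le> x 0 * w" by (rule power2_le_imp_le) (use x0(1) w(1) in simp)
  then have 1: "x 0 * (y 0 - w) \<le> C" using le by (simp add: form_split algebra_simps)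
  have C0: "C \<ge> 0" using order_trans[OF mult_nonneg_nonneg 1] x0 wy by simp
  have "(y 0 - w) * (y 0 + w) = 1" using w(2) by (simp add: algebra_simps)
  then have "x 0 = x 0 * (y 0 - w) * (y 0 + w)" by (simp add: mult.assoc)
  also have "\<dots> \<le> C * (y 0 + w)" using 1 y0 w by (intro mult_right_mono) auto
  also have "\<dots> \<le> C * (2 * y 0)" using wy C0 by (intro mult_left_mono) auto
  finally have 2: "x 0 \<le> 2 * C * y 0" by simp
  have "\<bar>x i\<bar> \<le> x 0"
  proof (cases "i = 0")
    case False
    then have "x i * x i \<le> ?s x x" using i by (intro member_le_sum) auto
    then have "(x i)\<^sup>2 \<le> (x 0)\<^sup>2" using x0 by (simp add: power2_eq_square)
    then show ?thesis using x0 by (simp add: abs_le_square_iff[symmetric])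
  qed (use x0 in simp)
  then show ?thesis using 2 by simp
qed

lemma sph_point_bound:
  assumes x: "x \<in> space_pts 1 d" and i: "i \<le> d"
  shows "\<bar>x i\<bar> \<le> 1"
proof -
  have "x i * x i \<le> (\<Sum>i\<le>d. x i * x i)" using i by (intro member_le_sum) auto
  then have "(x i)\<^sup>2 \<le> 1" using space_ptsD(2)[OF x] by (simp add: form_def power2_eq_square)
  then show ?thesis by (simp add: abs_square_le_1)
qed

lemma (in space_form) exists_dual:
  assumes v: "\<And>j. j \<le> d \<Longrightarrow> v j \<in> M" and ind: "lin_indep d v" and d: "d \<ge> 1"
  shows "\<exists>g. simplex e d v g"
proof -
  from lin_indep_inverse[OF ind] obtain H :: "nat \<Rightarrow> nat \<Rightarrow> real" where
    H1: "\<And>j k. j \<le> d \<Longrightarrow> k \<le> d \<Longrightarrow> (\<Sum>i\<le>d. H j i * v k i) = (if j = k then 1 else 0)" and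
    H2: "\<And>i k. i \<le> d \<Longrightarrow> k \<le> d \<Longrightarrow> (\<Sum>j\<le>d. v j i * H j k) = (if i = k then 1 else 0)" by blast
  \<comment> \<open>Rows of the inverse matrix are dual for the plain sum of products; the factor
    \<open>e\<close> at index 0 cancels the sign in \<open>B\<close>, and zeros beyond
    \<open>d\<close> put \<open>g j\<close> in \<open>ambient d\<close>.\<close>
  define g where "g = (\<lambda>j i. if i \<le> d then (if i = 0 then e else 1) * H j i else 0)"
  have Bg: "B (g j) x = (\<Sum>i\<le>d. H j i * x i)" for j x
    unfolding form_def g_def by (intro sum.cong) (auto simp: e_sq mult.assoc[symmetric])
  have "x i = (\<Sum>j\<le>d. B (g j) x * v j i)" if "i \<le> d" for x i
  proof -
    have "(\<Sum>j\<le>d. B (g j) x * v j i) = (\<Sum>j\<le>d. \<Sum>k\<le>d. x k * (v j i * H j k))"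
      unfolding Bg sum_distrib_right by (intro sum.cong) auto
    also have "\<dots> = (\<Sum>k\<le>d. x k * (\<Sum>j\<le>d. v j i * H j k))"
      by (subst sum.swap) (simp add: sum_distrib_left)
    also have "\<dots> = (\<Sum>k\<le>d. x k * (if i = k then 1 else 0))" using H2 that by simp
    also have "\<dots> = x i" using that by (simp add: if_distrib sum.delta' cong: if_cong)
    finally show ?thesis by simp
  qed
  then have "simplex e d v g" using v d H1 Bg by unfold_locales (auto simp: g_def ambient_def)
  then show ?thesis by blast
qed

section \<open>Hyperbolic simplices\<close>

lemma sqrt_one_minus_inverse_cosh:
  fixes R :: real
  assumes "R \<ge> 0"
  shows "sqrt (1 - 1 / (cosh R)\<^sup>2) = tanh R"
proof -
  have "(tanh R)\<^sup>2 = ((cosh R)\<^sup>2 - 1) / (cosh R)\<^sup>2" by (simp add: tanh_def power_divide sinh_square_eq)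
  then have "1 - 1 / (cosh R)\<^sup>2 = (tanh R)\<^sup>2" using cosh_real_pos[of R] by (simp add: diff_divide_distrib)
  then show ?thesis using assms by simp
qed

lemma tanh_artanh:
  fixes x :: real
  assumes "\<bar>x\<bar> < 1"
  shows "tanh (artanh x) = x"
proof -
  have "exp (- 2 * artanh x) = (1 - x) / (1 + x)"
    using assms by (simp add: artanh_def exp_minus)
  then have "tanh (artanh x) = (1 - (1 - x) / (1 + x)) / (1 + (1 - x) / (1 + x))"
    by (simp only: tanh_real_altdef)
  moreover have "1 - (1 - x) / (1 + x) = 2 * x / (1 + x)" "1 + (1 - x) / (1 + x) = 2 / (1 + x)"
    using assms by (simp_all add: field_simps)
  ultimately show ?thesis using assms by simp
qed

context hyp_simplex
begin

abbreviation in_radii where "in_radii \<equiv> {r. r \<ge> 0 \<and> (\<exists>c\<in>M. cball_in M (hdist d) c r \<subseteq> T)}"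
abbreviation out_radii where "out_radii \<equiv> {r. r \<ge> 0 \<and> (\<exists>c\<in>M. T \<subseteq> cball_in M (hdist d) c r)}"

lemma v_T: "j \<le> d \<Longrightarrow> v j \<in> T" using v_in_T by auto

lemma cosh_hdist: "x \<in> M \<Longrightarrow> y \<in> M \<Longrightarrow> cosh (hdist d x y) = - B x y"
  and hdist_nonneg: "x \<in> M \<Longrightarrow> y \<in> M \<Longrightarrow> hdist d x y \<ge> 0"
  using hdist_props by (auto simp: hyp_eq_space_pts)

lemma hdist_le_iff:
  assumes "x \<in> M" "y \<in> M" "r \<ge> 0"
  shows "hdist d x y \<le> r \<longleftrightarrow> - B x y \<le> cosh r"
  using cosh_hdist[OF assms(1,2)] hdist_nonneg[OF assms(1,2)] assms(3)
  by (metis cosh_real_nonneg_le_iff)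

text \<open>\<open>in_ball_dual\<close> supplies points with \<open>B x x = -1\<close> only, so the
  upper sheet must be secured: otherwise the negative of \<open>x\<close> would lie in
  \<open>M\<close> and have product \<open>cosh r\<close> with \<open>c\<close>, which is not at
  most \<open>-1\<close>.\<close>

lemma in_ball_le:
  assumes c: "c \<in> M" and r: "r \<ge> 0" and sub: "cball_in M (hdist d) c r \<subseteq> T" and j: "j \<le> d"
  shows "sinh r * sqrt (pf c (g j) (g j)) \<le> cosh r * B (g j) c"
proof (rule in_ball_dual[OF c _ j])
  show "-1 * (cosh r)\<^sup>2 + (sinh r)\<^sup>2 = -1" by (simp add: cosh_square_eq)
  show "c \<in> T" using sub c r space_ptsD(2)[OF c] cosh_real_ge_1[of r] by (auto simp: cball_in_def hdist_le_iff)
  fix x assume x: "x \<in> ambient d" "B x x = -1" "B c x = -1 * cosh r"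
  have "x 0 > 0"
  proof (rule ccontr)
    assume "\<not> x 0 > 0"
    moreover have "x 0 \<noteq> 0"
    proof
      assume "x 0 = 0"
      then have "B x x \<ge> 0" by (auto simp: form_split intro: sum_nonneg)
      then show False using x by simp
    qed
    ultimately have "comb (-1) x 0 x \<in> M"
      using x by (simp add: space_pts_def ambient_comb form_comb_left form_comb_right) (simp add: comb_def)
    then have "B c (comb (-1) x 0 x) \<le> -1" using hyp_form_le[OF c] by blast
    then show False using x(3) cosh_real_ge_1[of r] by (simp add: form_comb_right)
  qed
  then have "x \<in> M" using x by (simp add: space_pts_def)
  then show "x \<in> T" using sub x(3) c r by (auto simp: cball_in_def hdist_le_iff)
qed (rule cosh_real_nonneg)

lemma out_ball_le:
  assumes "p \<in> M" "r \<ge> 0" "T \<subseteq> cball_in M (hdist d) p r" "z \<in> T"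
  shows "- B p z \<le> cosh r"
  using assms by (auto simp: cball_in_def hdist_le_iff)

text \<open>Stated with the inequalities for facets and vertices instead of inclusions of balls,
  because these are what a limit of balls inherits.\<close>

lemma tanh_inequality:
  fixes r R :: real
  assumes c: "c \<in> M" and p: "p \<in> M" and r: "r \<ge> 0" and R: "R \<ge> 0"
    and in_ball: "\<And>j. j \<le> d \<Longrightarrow> sinh r * sqrt (pf c (g j) (g j)) \<le> cosh r * B (g j) c"
    and out_ball: "\<And>j. j \<le> d \<Longrightarrow> - B p (v j) \<le> cosh R"
  shows "d * tanh r \<le> tanh R"
    and "d * tanh r = tanh R \<Longrightarrow> \<exists>b. \<forall>i\<le>d. \<forall>j\<le>d. i \<noteq> j \<longrightarrow> B (v i) (v j) = b"
proof -
  have ch: "cosh r > 0" "cosh R > 0" by (rule cosh_real_pos)+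
  have th: "tanh r \<ge> 0" using r by simp
  have in_ball': "tanh r * sqrt (pf c (g j) (g j)) \<le> B (g j) c" if "j \<le> d" for j
    using in_ball[OF that] ch by (simp add: tanh_def field_simps)
  note main = radius_inequality[OF c p th cosh_real_ge_1 in_ball' out_ball, unfolded sqrt_one_minus_inverse_cosh[OF R]]
  show "d * tanh r \<le> tanh R" using main(1) by simp
  assume eq: "d * tanh r = tanh R"
  have R0: "R > 0"
  proof (rule ccontr)
    assume "\<not> R > 0"
    then have "R = 0" using R by simp
    obtain j where j: "j \<le> d" "-1 * B p (v j) \<noteq> 1" using vertices_not_concentrated[OF p] by blast
    then show False using out_ball[OF j(1)] hyp_form_le[OF p v_in[OF j(1)]] \<open>R = 0\<close> by simp
  qed
  then have "cosh R > 1" using cosh_real_nonneg_less_iff[of 0 R] by simp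
  then have pc: "p = c" using main(2) eq by simp
  have tR: "tanh R > 0" using R0 by simp
  have tr: "tanh r > 0" using eq tR th by (metis less_eq_real_def mult_zero_right less_irrefl)
  show "\<exists>b. \<forall>i\<le>d. \<forall>j\<le>d. i \<noteq> j \<longrightarrow> B (v i) (v j) = b"
  proof (rule concentric_equality[OF c tr eq in_ball'])
    fix j assume j: "j \<le> d"
    let ?a = "- B (v j) c"
    have a: "?a \<ge> 1" "?a \<le> cosh R"
      using hyp_form_le[OF v_in[OF j] c] out_ball[OF j] by (auto simp: pc form_sym[of "-1" d c])
    then have "?a\<^sup>2 \<le> (cosh R)\<^sup>2" by (intro power_mono) auto
    then have "?a\<^sup>2 / (cosh R)\<^sup>2 \<le> 1" using ch by simp
    then have "?a\<^sup>2 - 1 \<le> ?a\<^sup>2 * (1 - 1 / (cosh R)\<^sup>2)" by (simp add: algebra_simps)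
    moreover have "pf c (v j) (v j) = ?a\<^sup>2 - 1" using pf_self[OF v_in[OF j], of c] by simp
    ultimately have "sqrt (pf c (v j) (v j)) \<le> sqrt (?a\<^sup>2 * (1 - 1 / (cosh R)\<^sup>2))" by (metis real_sqrt_le_mono)
    also have "\<dots> = tanh R * (-1 * B (v j) c)"
      unfolding real_sqrt_mult sqrt_one_minus_inverse_cosh[OF R] using a by simp
    finally show "sqrt (pf c (v j) (v j)) \<le> tanh R * (-1 * B (v j) c)" .
  qed
qed

lemma weight_sum_le_1:
  assumes z: "z \<in> T"
  shows "(\<Sum>j\<le>d. B (g j) z) \<le> 1"
proof -
  have zM: "z \<in> M" using z by (simp add: T_def)
  have "-1 = (\<Sum>j\<le>d. B (g j) z * B (v j) z)" using expand_form_self[OF zM] by simp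
  also have "\<dots> \<le> (\<Sum>j\<le>d. B (g j) z * -1)"
    using z hyp_form_le[OF v_in zM] by (intro sum_mono mult_left_mono) (auto simp: T_def)
  finally show ?thesis by (simp add: sum_negf)
qed

text \<open>\<open>- B p z\<close> is a combination of its values at the vertices with non-negative
  coefficients of sum at most one.\<close>

lemma ball_contains_T:
  assumes p: "p \<in> M" and r: "r \<ge> 0" and le: "\<And>j. j \<le> d \<Longrightarrow> - B p (v j) \<le> cosh r"
  shows "T \<subseteq> cball_in M (hdist d) p r"
proof
  fix z assume z: "z \<in> T"
  have "z \<in> ambient d" using z by (auto simp: T_def dest: space_ptsD)
  then have "- B p z = (\<Sum>j\<le>d. B (g j) z * - B p (v j))"
    using expand_form[of z p] by (simp add: form_sym[of "-1" d p] sum_negf)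
  also have "\<dots> \<le> (\<Sum>j\<le>d. B (g j) z * cosh r)"
    using z le by (intro sum_mono mult_left_mono) (auto simp: T_def)
  also have "\<dots> = (\<Sum>j\<le>d. B (g j) z) * cosh r" by (simp add: sum_distrib_right)
  also have "\<dots> \<le> 1 * cosh r" using weight_sum_le_1[OF z] by (intro mult_right_mono) auto
  finally show "z \<in> cball_in M (hdist d) p r" using z p r by (simp add: T_def cball_in_def hdist_le_iff)
qed

lemma out_radii_nonempty: "\<exists>r. r \<in> out_radii"
proof -
  \<comment> \<open>All summands are at least one, so their sum dominates each of them and is a
    legitimate argument of \<open>arcosh\<close>.\<close>
  define K where "K = (\<Sum>j\<le>d. - B (v 0) (v j))"
  have ge1: "- B (v 0) (v j) \<ge> 1" if "j \<le> d" for j using hyp_form_le[OF v_in[of 0] v_in[OF that]] by simp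
  have K: "- B (v 0) (v j) \<le> K" if "j \<le> d" for j
    unfolding K_def using that ge1 by (intro member_le_sum) force+
  then have "K \<ge> 1" using order_trans[OF ge1[of 0] K[of 0]] by simp
  then have "T \<subseteq> cball_in M (hdist d) (v 0) (arcosh K)"
    using K by (intro ball_contains_T v_in) (auto simp: arcosh_nonneg_real cosh_arcosh_real)
  then show ?thesis using \<open>K \<ge> 1\<close> v_in[of 0] by (auto simp: arcosh_nonneg_real intro!: exI[of _ "arcosh K"])
qed

lemma zero_in_in_radii: "0 \<in> in_radii"
proof -
  have "x = v 0" if "x \<in> M" "hdist d (v 0) x \<le> 0" for x
  proof -
    have "- B (v 0) x \<le> 1" using that v_in[of 0] by (simp add: hdist_le_iff)
    then have 1: "B x (v 0) = -1" using hyp_form_le[OF that(1) v_in[of 0]] form_sym[of "-1" d x "v 0"] by simp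
    then have "pf (v 0) x x = 0" using pf_self[OF that(1)] by simp
    from pf_eq_0D[OF v_in[of 0] this] show ?thesis
      using 1 space_ptsD(1)[OF that(1)] space_ptsD(1)[OF v_in[of 0]] by (intro ambient_eqI) auto
  qed
  then have "cball_in M (hdist d) (v 0) 0 \<subseteq> {v 0}" by (auto simp: cball_in_def)
  then have "cball_in M (hdist d) (v 0) 0 \<subseteq> T" using v_T[of 0] by auto
  then show ?thesis using v_in[of 0] by auto
qed

lemma bdd_below_out_radii: "bdd_below out_radii"
  by (rule bdd_belowI[of _ 0]) simp

text \<open>The radius inequality itself gives the bound:
  \<open>tanh r \<le> d * tanh r \<le> tanh R\<close> for any fixed outer radius
  \<open>R\<close>.\<close>

lemma bdd_above_in_radii: "bdd_above in_radii"
proof -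
  obtain R p where R: "R \<ge> 0" "p \<in> M" "T \<subseteq> cball_in M (hdist d) p R" using out_radii_nonempty by auto
  have "r \<le> R" if "r \<ge> 0" "c \<in> M" "cball_in M (hdist d) c r \<subseteq> T" for r c
  proof -
    have "d * tanh r \<le> tanh R"
      using tanh_inequality(1)[OF that(2) R(2) that(1) R(1)] in_ball_le that out_ball_le R v_T by blast
    moreover have "tanh r \<le> d * tanh r" using that(1) dim_pos by (simp add: mult_le_cancel_right1)
    ultimately show ?thesis by (metis order_trans tanh_real_le_iff)
  qed
  then show ?thesis by (intro bdd_aboveI[of _ R]) auto
qed

text \<open>Centres of inner balls lie in \<open>T\<close>, hence in a fixed outer ball, so a
  subsequence converges; both sides of the facet inequality are continuous in centre and
  radius.\<close>

lemma inradius_attained: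
  "\<exists>c\<in>M. Sup in_radii \<ge> 0 \<and>
    (\<forall>j\<le>d. sinh (Sup in_radii) * sqrt (pf c (g j) (g j)) \<le> cosh (Sup in_radii) * B (g j) c)"
proof -
  obtain R p where R: "R \<ge> 0" "p \<in> M" "T \<subseteq> cball_in M (hdist d) p R" using out_radii_nonempty by auto
  obtain f where f: "\<And>n. f n \<in> in_radii" and lim: "f \<longlonglongrightarrow> Sup in_radii"
    using seq_to_Sup[OF zero_in_in_radii bdd_above_in_radii] by blast
  then have "\<forall>n. \<exists>c\<in>M. f n \<ge> 0 \<and> cball_in M (hdist d) c (f n) \<subseteq> T" by blast
  then obtain X where X: "\<And>n. X n \<in> M" "\<And>n. f n \<ge> 0" "\<And>n. cball_in M (hdist d) (X n) (f n) \<subseteq> T" by metis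
  have XT: "X n \<in> T" for n
    using X(1)[of n] X(2)[of n] X(3)[of n] space_ptsD(2)[OF X(1)] by (auto simp: cball_in_def hdist_le_iff cosh_real_ge_1)
  have bd: "\<bar>X n i\<bar> \<le> 2 * cosh R * p 0" if "i \<le> d" for n i
    using out_ball_le[OF R(2,1,3) XT[of n]] form_sym[of "-1" d p "X n"] by (intro hyp_point_bound[OF X(1) R(2) _ that]) simp
  have "\<forall>n. \<forall>i\<le>d. \<bar>X n i\<bar> \<le> 2 * cosh R * p 0" using bd by blast
  from bounded_points_limit[OF X(1) this] obtain \<phi> c where \<phi>: "strict_mono \<phi>" and c: "c \<in> M"
    and l: "\<And>y. (\<lambda>n. B (X (\<phi> n)) y) \<longlonglongrightarrow> B c y" by blast
  have l': "(\<lambda>n. B y (X (\<phi> n))) \<longlonglongrightarrow> B y c" for y using l form_sym[of "-1" d y] by simp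
  have fl: "(\<lambda>n. f (\<phi> n)) \<longlonglongrightarrow> Sup in_radii" using LIMSEQ_subseq_LIMSEQ[OF lim \<phi>] by (simp add: o_def)
  have "sinh (Sup in_radii) * sqrt (pf c (g j) (g j)) \<le> cosh (Sup in_radii) * B (g j) c" if "j \<le> d" for j
  proof (rule LIMSEQ_le)
    show "(\<lambda>n. sinh (f (\<phi> n)) * sqrt (pf (X (\<phi> n)) (g j) (g j))) \<longlonglongrightarrow> sinh (Sup in_radii) * sqrt (pf c (g j) (g j))"
      by (intro tendsto_intros tendsto_pf fl l)
    show "(\<lambda>n. cosh (f (\<phi> n)) * B (g j) (X (\<phi> n))) \<longlonglongrightarrow> cosh (Sup in_radii) * B (g j) c"
      by (intro tendsto_intros fl l')
    show "\<exists>N. \<forall>n\<ge>N. sinh (f (\<phi> n)) * sqrt (pf (X (\<phi> n)) (g j) (g j)) \<le> cosh (f (\<phi> n)) * B (g j) (X (\<phi> n))"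
      using in_ball_le X that by blast
  qed
  then show ?thesis using c cSup_upper[OF zero_in_in_radii bdd_above_in_radii] by blast
qed

text \<open>The centres stay within distance \<open>r\<close> of the vertex \<open>v 0\<close>,
  which supplies the compactness.\<close>

lemma circumradius_attained:
  "\<exists>p\<in>M. Inf out_radii \<ge> 0 \<and> (\<forall>j\<le>d. - B p (v j) \<le> cosh (Inf out_radii))"
proof -
  obtain r where r: "r \<in> out_radii" using out_radii_nonempty by blast
  obtain f where f: "\<And>n. f n \<in> out_radii" "\<And>n. f n \<le> r" and lim: "f \<longlonglongrightarrow> Inf out_radii"
    using seq_to_Inf[OF r bdd_below_out_radii] by blast
  then have "\<forall>n. \<exists>c\<in>M. f n \<ge> 0 \<and> T \<subseteq> cball_in M (hdist d) c (f n)" by blast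
  then obtain X where X: "\<And>n. X n \<in> M" "\<And>n. f n \<ge> 0" "\<And>n. T \<subseteq> cball_in M (hdist d) (X n) (f n)" by metis
  have le: "- B (X n) (v j) \<le> cosh (f n)" if "j \<le> d" for n j
    using out_ball_le[OF X v_T[OF that]] .
  have bd: "\<bar>X n i\<bar> \<le> 2 * cosh r * v 0 0" if "i \<le> d" for n i
  proof (rule hyp_point_bound[OF X(1) v_in _ that])
    have "cosh (f n) \<le> cosh r" using X(2) f(2) order_trans[OF X(2) f(2)] by (simp add: cosh_real_nonneg_le_iff)
    then show "- B (X n) (v 0) \<le> cosh r" using le[of 0 n] by simp
  qed simp
  have "\<forall>n. \<forall>i\<le>d. \<bar>X n i\<bar> \<le> 2 * cosh r * v 0 0" using bd by blast
  from bounded_points_limit[OF X(1) this] obtain \<phi> p where \<phi>: "strict_mono \<phi>" and p: "p \<in> M"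
    and l: "\<And>y. (\<lambda>n. B (X (\<phi> n)) y) \<longlonglongrightarrow> B p y" by blast
  have fl: "(\<lambda>n. f (\<phi> n)) \<longlonglongrightarrow> Inf out_radii" using LIMSEQ_subseq_LIMSEQ[OF lim \<phi>] by (simp add: o_def)
  have "- B p (v j) \<le> cosh (Inf out_radii)" if "j \<le> d" for j
  proof (rule LIMSEQ_le)
    show "(\<lambda>n. - B (X (\<phi> n)) (v j)) \<longlonglongrightarrow> - B p (v j)" by (intro tendsto_intros l)
    show "(\<lambda>n. cosh (f (\<phi> n))) \<longlonglongrightarrow> cosh (Inf out_radii)" by (intro tendsto_intros fl)
  qed (use le that in blast)
  moreover have "Inf out_radii \<ge> 0" using r by (intro cInf_greatest) auto
  ultimately show ?thesis using p by blast
qed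

text \<open>Both balls are centred at the point from \<open>regular_centre\<close>: the outer sphere
  passes through the vertices, and \<open>r\<close> is prescribed by the desired equality.\<close>

lemma regular_radii:
  assumes b: "\<forall>i\<le>d. \<forall>j\<le>d. i \<noteq> j \<longrightarrow> B (v i) (v j) = b"
  shows "\<exists>r\<in>in_radii. \<exists>R\<in>out_radii. tanh R = d * tanh r"
proof -
  obtain c and a \<gamma> :: real where c: "c \<in> M" and a: "a > 0" and \<gamma>: "\<gamma> > 0" and a1: "-1 * (1 - a\<^sup>2) > 0"
    and all: "\<forall>j\<le>d. -1 * B (v j) c = a \<and> B (g j) c = \<gamma> \<and>
      sqrt (pf c (g j) (g j)) * sqrt (-1 * (1 - a\<^sup>2)) = d * (a * \<gamma>)"
    using regular_centre[OF b] by (elim bexE exE conjE) (rule that; assumption)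
  note va = all[rule_format, THEN conjunct1] and g\<gamma> = all[rule_format, THEN conjunct2, THEN conjunct1]
    and GV = all[rule_format, THEN conjunct2, THEN conjunct2]
  have d0: "real d > 0" using dim_pos by simp
  have a2: "a\<^sup>2 > 1" using a1 by simp
  then have a_gt1: "a > 1" using a by (metis one_power2 power2_less_imp_less less_imp_le)
  define R where "R = arcosh a"
  have R: "cosh R = a" "R > 0" using a_gt1 by (auto simp: R_def cosh_arcosh_real arcosh_real_gt_1_iff)
  have shR: "sinh R = sqrt (-1 * (1 - a\<^sup>2))" unfolding R(1)[symmetric] using R(2) by (simp add: cosh_square_eq)
  have tR: "tanh R > 0" "tanh R < 1" using R(2) tanh_real_lt_1 by auto
  \<comment> \<open>\<open>tanh R < 1\<close> and \<open>d \<ge> 1\<close> keep the argument inside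
    the domain of \<open>artanh\<close>.\<close>
  define r where "r = artanh (tanh R / d)"
  have lt: "tanh R / d < 1" "tanh R / d \<ge> 0"
    using tR dim_pos d0 by (auto simp: field_simps intro: less_le_trans)
  then have tr: "tanh r = tanh R / d" unfolding r_def by (intro tanh_artanh) auto
  have r0: "r \<ge> 0" using tr lt by (metis tanh_real_nonneg_iff)
  have "R \<in> out_radii"
    using ball_contains_T[OF c, of R] R va form_sym[of "-1" d c] c by auto
  moreover have "cball_in M (hdist d) c r \<subseteq> T"
  proof
    fix z assume "z \<in> cball_in M (hdist d) c r"
    then have z: "z \<in> M" and zr: "hdist d c z \<le> r" by (auto simp: cball_in_def)
    define \<delta> where "\<delta> = hdist d c z"
    have \<delta>: "\<delta> \<ge> 0" "cosh \<delta> = - B c z" "\<delta> \<le> r" using c z zr by (auto simp: \<delta>_def hdist_nonneg cosh_hdist)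
    have "B (g j) z \<ge> 0" if j: "j \<le> d" for j
    proof -
      let ?G = "sqrt (pf c (g j) (g j))"
      have "B z c = - cosh \<delta>" using \<delta>(2) form_sym[of "-1" d z c] by simp
      then have "pf c z z = (sinh \<delta>)\<^sup>2" using pf_self[OF z, of c] by (simp add: cosh_square_eq)
      then have 1: "sqrt (pf c z z) = sinh \<delta>" using \<delta>(1) by simp
      have 2: "B (g j) z = pf c (g j) z + \<gamma> * cosh \<delta>"
        using \<open>B z c = - cosh \<delta>\<close> by (simp add: pf_def g\<gamma>[OF j])
      have "?G * sinh R = d * \<gamma> * cosh R" using GV[OF j] shR R(1) by simp
      then have "?G * tanh R = d * \<gamma>" using cosh_real_pos[of R] by (simp add: tanh_def field_simps)
      \<comment> \<open>The ball of this radius just touches the facet: equality in the facet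
        inequality.\<close>
      then have 3: "?G * tanh r = \<gamma>" unfolding tr using d0 by (simp add: field_simps)
      have "?G * tanh \<delta> \<le> ?G * tanh r" using \<delta>(3) pf_nonneg[OF c] by (intro mult_left_mono) auto
      then have "?G * tanh \<delta> \<le> \<gamma>" using 3 by simp
      then have "?G * sinh \<delta> \<le> \<gamma> * cosh \<delta>" using cosh_real_pos[of \<delta>] by (simp add: tanh_def field_simps)
      then show ?thesis using pf_ge_sqrt[OF c, of "g j" z] 1 2 by simp
    qed
    then show "z \<in> T" using z by (simp add: T_def)
  qed
  then have "r \<in> in_radii" using r0 c by auto
  moreover have "tanh R = d * tanh r" using tr d0 by simp
  ultimately show ?thesis by blast
qed

text \<open>For regular simplices the radii from \<open>regular_radii\<close> need not be known to
  be extremal: they squeeze \<open>tanh (Inf out_radii)\<close> from above by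
  \<open>d * tanh (Sup in_radii)\<close>, and the general inequality is the other half.\<close>

lemma radii_theorem:
  "tanh (Inf out_radii) \<ge> d * tanh (Sup in_radii)"
  "tanh (Inf out_radii) = d * tanh (Sup in_radii) \<longleftrightarrow> (\<exists>b. \<forall>i\<le>d. \<forall>j\<le>d. i \<noteq> j \<longrightarrow> B (v i) (v j) = b)"
proof -
  obtain c where c: "c \<in> M" "Sup in_radii \<ge> 0"
    "\<And>j. j \<le> d \<Longrightarrow> sinh (Sup in_radii) * sqrt (pf c (g j) (g j)) \<le> cosh (Sup in_radii) * B (g j) c"
    using inradius_attained by blast
  obtain p where p: "p \<in> M" "Inf out_radii \<ge> 0" "\<And>j. j \<le> d \<Longrightarrow> - B p (v j) \<le> cosh (Inf out_radii)"
    using circumradius_attained by blast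
  note main = tanh_inequality[OF c(1) p(1) c(2) p(2) c(3) p(3)]
  show le: "tanh (Inf out_radii) \<ge> d * tanh (Sup in_radii)" by (rule main(1))
  show "tanh (Inf out_radii) = d * tanh (Sup in_radii) \<longleftrightarrow> (\<exists>b. \<forall>i\<le>d. \<forall>j\<le>d. i \<noteq> j \<longrightarrow> B (v i) (v j) = b)"
  proof
    assume "tanh (Inf out_radii) = d * tanh (Sup in_radii)"
    from main(2)[OF _ _ this[symmetric]] show "\<exists>b. \<forall>i\<le>d. \<forall>j\<le>d. i \<noteq> j \<longrightarrow> B (v i) (v j) = b" by blast
  next
    assume "\<exists>b. \<forall>i\<le>d. \<forall>j\<le>d. i \<noteq> j \<longrightarrow> B (v i) (v j) = b"
    then obtain b where "\<forall>i\<le>d. \<forall>j\<le>d. i \<noteq> j \<longrightarrow> B (v i) (v j) = b" ..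
    from regular_radii[OF this] obtain r R where r: "r \<in> in_radii" "R \<in> out_radii" "tanh R = d * tanh r"
      by (elim bexE) (rule that; assumption)
    have "tanh (Inf out_radii) \<le> tanh R"
      using cInf_lower[OF r(2) bdd_below_out_radii] by (simp only: tanh_real_le_iff)
    also have "\<dots> = d * tanh r" by (rule r(3))
    also have "\<dots> \<le> d * tanh (Sup in_radii)"
      using cSup_upper[OF r(1) bdd_above_in_radii] by (intro mult_left_mono) (simp_all only: tanh_real_le_iff of_nat_0_le_iff)
    finally show "tanh (Inf out_radii) = d * tanh (Sup in_radii)" using le by simp
  qed
qed

lemma regular_iff:
  "regular_simplex (hdist d) d v \<longleftrightarrow> (\<exists>b. \<forall>i\<le>d. \<forall>j\<le>d. i \<noteq> j \<longrightarrow> B (v i) (v j) = b)"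
proof
  assume reg: "regular_simplex (hdist d) d v"
  have "B (v i) (v j) = - cosh (hdist d (v 0) (v 1))" if "i \<le> d" "j \<le> d" "i \<noteq> j" for i j
  proof -
    have "hdist d (v i) (v j) = hdist d (v 0) (v 1)"
      using reg that dim_pos unfolding regular_simplex_def by (metis le0 zero_neq_one)
    then show ?thesis using cosh_hdist[OF v_in v_in] that by (metis minus_minus)
  qed
  then show "\<exists>b. \<forall>i\<le>d. \<forall>j\<le>d. i \<noteq> j \<longrightarrow> B (v i) (v j) = b" by blast
next
  assume "\<exists>b. \<forall>i\<le>d. \<forall>j\<le>d. i \<noteq> j \<longrightarrow> B (v i) (v j) = b"
  then show "regular_simplex (hdist d) d v"
    unfolding regular_simplex_def hdist_def lor_eq_form by metis
qed

end

section \<open>Spherical simplices\<close>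

lemma sqrt_one_minus_cos:
  fixes R :: real
  assumes "R \<ge> 0" "R \<le> pi"
  shows "sqrt (1 - (cos R)\<^sup>2) / cos R = tan R"
  using assms sin_ge_zero[of R] by (simp add: tan_def flip: sin_squared_eq)

context sph_simplex
begin

abbreviation in_radii where "in_radii \<equiv> {r. r \<ge> 0 \<and> (\<exists>c\<in>M. cball_in M (sdist d) c r \<subseteq> T)}"
abbreviation out_radii where "out_radii \<equiv> {r. r \<ge> 0 \<and> (\<exists>c\<in>M. T \<subseteq> cball_in M (sdist d) c r)}"

lemma v_T: "j \<le> d \<Longrightarrow> v j \<in> T" using v_in_T by auto

lemma form_le_1: "x \<in> M \<Longrightarrow> y \<in> M \<Longrightarrow> B x y \<le> 1"
  using sph_form_bounds by (auto simp: sph_eq_space_pts)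

lemma cos_sdist: "x \<in> M \<Longrightarrow> y \<in> M \<Longrightarrow> cos (sdist d x y) = B x y"
  and sdist_nonneg: "x \<in> M \<Longrightarrow> y \<in> M \<Longrightarrow> sdist d x y \<ge> 0"
  and sdist_le_pi: "x \<in> M \<Longrightarrow> y \<in> M \<Longrightarrow> sdist d x y \<le> pi"
  using sdist_props by (auto simp: sph_eq_space_pts)

lemma sdist_le_iff:
  assumes "x \<in> M" "y \<in> M" "r \<ge> 0" "r \<le> pi"
  shows "sdist d x y \<le> r \<longleftrightarrow> cos r \<le> B x y"
  using cos_sdist[OF assms(1,2)] sdist_nonneg[OF assms(1,2)] sdist_le_pi[OF assms(1,2)] assms(3,4)
  by (metis cos_mono_le_eq)

lemma in_ball_le:
  assumes c: "c \<in> M" and r: "r \<ge> 0" "r \<le> pi / 2" and sub: "cball_in M (sdist d) c r \<subseteq> T" and j: "j \<le> d"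
  shows "sin r * sqrt (pf c (g j) (g j)) \<le> cos r * B (g j) c"
proof (rule in_ball_dual[OF c _ j])
  have rpi: "r \<le> pi" using r pi_ge_zero by linarith
  show "1 * (cos r)\<^sup>2 + (sin r)\<^sup>2 = 1" by simp
  show "c \<in> T" using sub c r(1) rpi space_ptsD(2)[OF c] by (auto simp: cball_in_def sdist_le_iff)
  show "cos r \<ge> 0" using r by (intro cos_ge_zero) auto
  fix x assume x: "x \<in> ambient d" "B x x = 1" "B c x = 1 * cos r"
  then have "x \<in> M" by (simp add: space_pts_def)
  then show "x \<in> T" using sub x(3) c r(1) rpi by (auto simp: cball_in_def sdist_le_iff)
qed

text \<open>At radius \<open>pi / 2\<close> the cosine vanishes and the facet inequality would make
  all projected \<open>g j\<close> zero.\<close>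

lemma in_ball_lt_half_pi:
  assumes c: "c \<in> M" and r: "r \<ge> 0" and sub: "cball_in M (sdist d) c r \<subseteq> T"
  shows "r < pi / 2"
proof (rule ccontr)
  assume "\<not> r < pi / 2"
  then have "cball_in M (sdist d) c (pi / 2) \<subseteq> T" using sub by (auto simp: cball_in_def)
  from in_ball_le[OF c _ order_refl this] have "sqrt (pf c (g j) (g j)) \<le> 0" if "j \<le> d" for j
    using that by simp
  moreover obtain j where "j \<le> d" "pf c (g j) (g j) > 0" using g_pf_pos[OF c] by blast
  ultimately show False by (meson not_le real_sqrt_gt_zero)
qed

lemma out_ball_le:
  assumes "p \<in> M" "r \<ge> 0" "r \<le> pi" "T \<subseteq> cball_in M (sdist d) p r" "z \<in> T"
  shows "cos r \<le> B p z"
  using assms by (auto simp: cball_in_def sdist_le_iff)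

lemma tan_inequality:
  fixes r R :: real
  assumes c: "c \<in> M" and p: "p \<in> M" and r: "r \<ge> 0" "r < pi / 2" and R: "R \<ge> 0" "R < pi / 2"
    and in_ball: "\<And>j. j \<le> d \<Longrightarrow> sin r * sqrt (pf c (g j) (g j)) \<le> cos r * B (g j) c"
    and out_ball: "\<And>j. j \<le> d \<Longrightarrow> cos R \<le> B p (v j)"
  shows "d * tan r \<le> tan R"
    and "d * tan r = tan R \<Longrightarrow> \<exists>b. \<forall>i\<le>d. \<forall>j\<le>d. i \<noteq> j \<longrightarrow> B (v i) (v j) = b"
proof -
  have Rpi: "R \<le> pi" using R pi_ge_zero by linarith
  have co: "cos r > 0" "cos R > 0" using r R by (auto intro!: cos_gt_zero_pi)
  have si: "sin r \<ge> 0" using r pi_ge_zero by (intro sin_ge_zero) auto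
  have th: "tan r \<ge> 0" using co si by (simp add: tan_def)
  have tan_r: "sin r / cos r = tan r" by (simp add: tan_def)
  note main = radius_inequality[OF c p si co(1) sin_cos_squared_add co(2) in_ball out_ball,
    unfolded sqrt_one_minus_cos[OF R(1) Rpi] tan_r]
  show "d * tan r \<le> tan R" using main(1) by simp
  assume eq: "d * tan r = tan R"
  have R0: "R > 0"
  proof (rule ccontr)
    assume "\<not> R > 0"
    then have "R = 0" using R by simp
    obtain j where j: "j \<le> d" "1 * B p (v j) \<noteq> 1" using vertices_not_concentrated[OF p] by blast
    then show False using out_ball[OF j(1)] form_le_1[OF p v_in[OF j(1)]] \<open>R = 0\<close> by simp
  qed
  then have "cos R < 1" using cos_monotone_0_pi[of 0 R] Rpi by simp
  then have pc: "p = c" using main(2) eq by simp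
  have tR: "tan R > 0" using R0 R by (intro tan_gt_zero)
  have tr: "tan r > 0" using eq tR th by (metis less_eq_real_def mult_zero_right less_irrefl)
  have in_ball': "tan r * sqrt (pf c (g j) (g j)) \<le> B (g j) c" if "j \<le> d" for j
    using in_ball[OF that] co by (simp add: tan_def field_simps)
  show "\<exists>b. \<forall>i\<le>d. \<forall>j\<le>d. i \<noteq> j \<longrightarrow> B (v i) (v j) = b"
  proof (rule concentric_equality[OF c tr eq in_ball'])
    fix j assume j: "j \<le> d"
    let ?a = "B (v j) c"
    have a: "cos R \<le> ?a" using out_ball[OF j] by (simp add: pc form_sym[of 1 d c])
    have sR: "sin R \<ge> 0" using R Rpi by (intro sin_ge_zero)
    \<comment> \<open>The vertex is within \<open>R\<close> of \<open>c\<close>, and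
      \<open>sin R\<close> is then traded for \<open>tan R * cos R\<close>, where
      \<open>cos R\<close> is at most \<open>?a\<close>.\<close>
    have "sqrt (pf c (v j) (v j)) \<le> sin R"
    proof (rule real_le_lsqrt[OF sR])
      have "(cos R)\<^sup>2 \<le> ?a\<^sup>2" using a co by (intro power_mono) auto
      then show "pf c (v j) (v j) \<le> (sin R)\<^sup>2" using pf_self[OF v_in[OF j], of c] by (simp add: sin_squared_eq)
    qed
    also have "sin R = tan R * cos R" using co by (simp add: tan_def)
    also have "\<dots> \<le> tan R * (1 * ?a)" using a tR by simp
    finally show "sqrt (pf c (v j) (v j)) \<le> tan R * (1 * ?a)" .
  qed
qed

lemma weight_sum_ge_1:
  assumes z: "z \<in> T"
  shows "(\<Sum>j\<le>d. B (g j) z) \<ge> 1"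
proof -
  have zM: "z \<in> M" using z by (simp add: T_def)
  have "1 = (\<Sum>j\<le>d. B (g j) z * B (v j) z)" using expand_form_self[OF zM] by simp
  also have "\<dots> \<le> (\<Sum>j\<le>d. B (g j) z * 1)"
    using z form_le_1[OF v_in zM] by (intro sum_mono mult_left_mono) (auto simp: T_def)
  finally show ?thesis by simp
qed

text \<open>On the sphere the coordinates of a point of \<open>T\<close> add up to at least one; the
  bound passes from the vertices to \<open>z\<close> because \<open>cos r \<ge> 0\<close>.\<close>

lemma ball_contains_T:
  assumes p: "p \<in> M" and r: "r \<ge> 0" "r \<le> pi / 2" and le: "\<And>j. j \<le> d \<Longrightarrow> cos r \<le> B p (v j)"
  shows "T \<subseteq> cball_in M (sdist d) p r"
proof
  have rpi: "r \<le> pi" using r pi_ge_zero by linarith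
  have co: "cos r \<ge> 0" using r by (intro cos_ge_zero) auto
  fix z assume z: "z \<in> T"
  then have "z \<in> ambient d" by (auto simp: T_def dest: space_ptsD)
  have "1 * cos r \<le> (\<Sum>j\<le>d. B (g j) z) * cos r" using weight_sum_ge_1[OF z] co by (intro mult_right_mono)
  also have "\<dots> = (\<Sum>j\<le>d. B (g j) z * cos r)" by (simp add: sum_distrib_right)
  also have "\<dots> \<le> (\<Sum>j\<le>d. B (g j) z * B p (v j))"
    using z le by (intro sum_mono mult_left_mono) (auto simp: T_def)
  also have "\<dots> = B p z"
    using expand_form[OF \<open>z \<in> ambient d\<close>, of p] by (simp add: form_sym[of 1 d p])
  finally show "z \<in> cball_in M (sdist d) p r" using z p r(1) rpi by (simp add: T_def cball_in_def sdist_le_iff)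
qed

text \<open>The sum \<open>u\<close> of the dual vectors has product one with every vertex.
  Normalised, it is a point equidistant from all vertices, at a distance with positive cosine
  \<open>1 / n\<close>; so the simplex fits into a cap smaller than a hemisphere, where
  \<open>tan\<close> is monotone.\<close>

lemma out_radii_small: "\<exists>r. r \<in> out_radii \<and> r < pi / 2"
proof -
  define u where "u = (\<lambda>i. \<Sum>j\<le>d. 1 * g j i)"
  have uv: "B u (v i) = 1" if "i \<le> d" for i
    unfolding u_def form_sum_left using dual that by (simp add: sum.delta)
  have uamb: "u \<in> ambient d" unfolding u_def using g_ambient by (intro ambient_sum) auto
  have upos: "B u u > 0"
  proof -
    have "B u u \<ge> 0" by (auto simp: form_def intro: sum_nonneg)
    moreover have "B u u \<noteq> 0"
    proof
      assume "B u u = 0"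
      then have "(\<Sum>i\<le>d. u i * u i) = 0" by (simp add: form_def)
      then have "\<forall>i\<le>d. u i = 0" by (subst (asm) sum_nonneg_eq_0_iff) auto
      then have "B u (v 0) = 0" by (simp add: form_def)
      then show False using uv[of 0] by simp
    qed
    ultimately show ?thesis by simp
  qed
  define n where "n = sqrt (1 * B u u)"
  have n: "n > 0" using upos by (simp add: n_def)
  define p where "p = comb (1 / n) u 0 u"
  have p: "p \<in> M" unfolding p_def n_def using upos by (intro normalize_in uamb) auto
  have pv: "B p (v j) = 1 / n" if "j \<le> d" for j using uv[OF that] by (simp add: p_def form_comb_left)
  have n1: "1 / n \<le> 1" "1 / n > 0" using form_le_1[OF p v_in[of 0]] pv[of 0] n by auto
  define r where "r = arccos (1 / n)"
  have r: "cos r = 1 / n" "r \<ge> 0" using n1 n unfolding r_def by (intro cos_arccos arccos_lbound; linarith)+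
  have rp: "r < pi / 2" using arccos_less_arccos[of 0 "1 / n"] n1 by (simp add: r_def)
  have "T \<subseteq> cball_in M (sdist d) p r"
    using r rp pv by (intro ball_contains_T p) auto
  then show ?thesis using p r rp by auto
qed

lemma zero_in_in_radii: "0 \<in> in_radii"
proof -
  have "x = v 0" if "x \<in> M" "sdist d (v 0) x \<le> 0" for x
  proof -
    have "1 \<le> B (v 0) x" using that v_in[of 0] by (simp add: sdist_le_iff)
    then have 1: "B x (v 0) = 1" using form_le_1[OF that(1) v_in[of 0]] form_sym[of 1 d x "v 0"] by simp
    then have "pf (v 0) x x = 0" using pf_self[OF that(1)] by simp
    from pf_eq_0D[OF v_in[of 0] this] show ?thesis
      using 1 space_ptsD(1)[OF that(1)] space_ptsD(1)[OF v_in[of 0]] by (intro ambient_eqI) auto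
  qed
  then have "cball_in M (sdist d) (v 0) 0 \<subseteq> {v 0}" by (auto simp: cball_in_def)
  then have "cball_in M (sdist d) (v 0) 0 \<subseteq> T" using v_T[of 0] by auto
  then show ?thesis using v_in[of 0] by auto
qed

lemma bdd_below_out_radii: "bdd_below out_radii"
  by (rule bdd_belowI[of _ 0]) simp

lemma bdd_above_in_radii: "bdd_above in_radii"
  using in_ball_lt_half_pi by (intro bdd_aboveI[of _ "pi / 2"]) (auto intro: less_imp_le)

lemma inradius_attained:
  "\<exists>c\<in>M. Sup in_radii \<ge> 0 \<and> Sup in_radii < pi / 2 \<and>
    (\<forall>j\<le>d. sin (Sup in_radii) * sqrt (pf c (g j) (g j)) \<le> cos (Sup in_radii) * B (g j) c)"
proof -
  obtain f where f: "\<And>n. f n \<in> in_radii" and lim: "f \<longlonglongrightarrow> Sup in_radii"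
    using seq_to_Sup[OF zero_in_in_radii bdd_above_in_radii] by blast
  then have "\<forall>n. \<exists>c\<in>M. f n \<ge> 0 \<and> cball_in M (sdist d) c (f n) \<subseteq> T" by blast
  then obtain X where X: "\<And>n. X n \<in> M" "\<And>n. f n \<ge> 0" "\<And>n. cball_in M (sdist d) (X n) (f n) \<subseteq> T" by metis
  have "\<forall>n. \<forall>i\<le>d. \<bar>X n i\<bar> \<le> 1" using sph_point_bound X(1) by blast
  from bounded_points_limit[OF X(1) this] obtain \<phi> c where \<phi>: "strict_mono \<phi>" and c: "c \<in> M"
    and l: "\<And>y. (\<lambda>n. B (X (\<phi> n)) y) \<longlonglongrightarrow> B c y" by blast
  have l': "(\<lambda>n. B y (X (\<phi> n))) \<longlonglongrightarrow> B y c" for y using l form_sym[of 1 d y] by simp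
  have fl: "(\<lambda>n. f (\<phi> n)) \<longlonglongrightarrow> Sup in_radii" using LIMSEQ_subseq_LIMSEQ[OF lim \<phi>] by (simp add: o_def)
  have fpi: "f n \<le> pi / 2" for n using in_ball_lt_half_pi[OF X] by (rule less_imp_le)
  have K: "sin (Sup in_radii) * sqrt (pf c (g j) (g j)) \<le> cos (Sup in_radii) * B (g j) c" if "j \<le> d" for j
  proof (rule LIMSEQ_le)
    show "(\<lambda>n. sin (f (\<phi> n)) * sqrt (pf (X (\<phi> n)) (g j) (g j))) \<longlonglongrightarrow> sin (Sup in_radii) * sqrt (pf c (g j) (g j))"
      by (intro tendsto_intros tendsto_pf fl l)
    show "(\<lambda>n. cos (f (\<phi> n)) * B (g j) (X (\<phi> n))) \<longlonglongrightarrow> cos (Sup in_radii) * B (g j) c"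
      by (intro tendsto_intros fl l')
    show "\<exists>N. \<forall>n\<ge>N. sin (f (\<phi> n)) * sqrt (pf (X (\<phi> n)) (g j) (g j)) \<le> cos (f (\<phi> n)) * B (g j) (X (\<phi> n))"
      using in_ball_le[OF X(1) X(2) fpi X(3) that] by blast
  qed
  have "Sup in_radii \<le> pi / 2" using fpi by (intro LIMSEQ_le_const2[OF lim]) auto
  \<comment> \<open>Each inner radius is below \<open>pi / 2\<close>, but the supremum could still
    reach it; the limiting facet inequality excludes this.\<close>
  moreover have "Sup in_radii \<noteq> pi / 2"
  proof
    assume eq: "Sup in_radii = pi / 2"
    obtain j where j: "j \<le> d" "pf c (g j) (g j) > 0" using g_pf_pos[OF c] by blast
    then show False using K[OF j(1)] unfolding eq by simp
  qed
  ultimately have "Sup in_radii < pi / 2" by simp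
  then show ?thesis using K c cSup_upper[OF zero_in_in_radii bdd_above_in_radii] by blast
qed

lemma circumradius_attained:
  "\<exists>p\<in>M. Inf out_radii \<ge> 0 \<and> Inf out_radii < pi / 2 \<and> (\<forall>j\<le>d. cos (Inf out_radii) \<le> B p (v j))"
proof -
  obtain r where r: "r \<in> out_radii" and rp: "r < pi / 2" using out_radii_small by blast
  obtain f where f: "\<And>n. f n \<in> out_radii" "\<And>n. f n \<le> r" and lim: "f \<longlonglongrightarrow> Inf out_radii"
    using seq_to_Inf[OF r bdd_below_out_radii] by blast
  then have "\<forall>n. \<exists>c\<in>M. f n \<ge> 0 \<and> T \<subseteq> cball_in M (sdist d) c (f n)" by blast
  then obtain X where X: "\<And>n. X n \<in> M" "\<And>n. f n \<ge> 0" "\<And>n. T \<subseteq> cball_in M (sdist d) (X n) (f n)" by metis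
  have fpi: "f n \<le> pi" for n using f(2)[of n] rp pi_ge_zero by linarith
  have le: "cos (f n) \<le> B (X n) (v j)" if "j \<le> d" for n j
    using out_ball_le[OF X(1) X(2) fpi X(3) v_T[OF that]] .
  have "\<forall>n. \<forall>i\<le>d. \<bar>X n i\<bar> \<le> 1" using sph_point_bound X(1) by blast
  from bounded_points_limit[OF X(1) this] obtain \<phi> p where \<phi>: "strict_mono \<phi>" and p: "p \<in> M"
    and l: "\<And>y. (\<lambda>n. B (X (\<phi> n)) y) \<longlonglongrightarrow> B p y" by blast
  have fl: "(\<lambda>n. f (\<phi> n)) \<longlonglongrightarrow> Inf out_radii" using LIMSEQ_subseq_LIMSEQ[OF lim \<phi>] by (simp add: o_def)
  have "cos (Inf out_radii) \<le> B p (v j)" if "j \<le> d" for j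
  proof (rule LIMSEQ_le)
    show "(\<lambda>n. B (X (\<phi> n)) (v j)) \<longlonglongrightarrow> B p (v j)" by (rule l)
    show "(\<lambda>n. cos (f (\<phi> n))) \<longlonglongrightarrow> cos (Inf out_radii)" by (intro tendsto_intros fl)
  qed (use le that in blast)
  moreover have "Inf out_radii \<ge> 0" using r by (intro cInf_greatest) auto
  moreover have "Inf out_radii < pi / 2"
    using cInf_lower[OF r bdd_below_out_radii] rp by (rule le_less_trans)
  ultimately show ?thesis using p by blast
qed

text \<open>As in the hyperbolic case, with \<open>arctan\<close> defining \<open>r\<close>. Since
  \<open>cos R = a\<close> is positive, \<open>R\<close> is below \<open>pi / 2\<close>.\<close>

lemma regular_radii:
  assumes b: "\<forall>i\<le>d. \<forall>j\<le>d. i \<noteq> j \<longrightarrow> B (v i) (v j) = b"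
  shows "\<exists>r\<in>in_radii. \<exists>R\<in>out_radii. R < pi / 2 \<and> tan R = d * tan r"
proof -
  obtain c and a \<gamma> :: real where c: "c \<in> M" and a: "a > 0" and \<gamma>: "\<gamma> > 0" and a1: "1 * (1 - a\<^sup>2) > 0"
    and all: "\<forall>j\<le>d. 1 * B (v j) c = a \<and> B (g j) c = \<gamma> \<and>
      sqrt (pf c (g j) (g j)) * sqrt (1 * (1 - a\<^sup>2)) = d * (a * \<gamma>)"
    using regular_centre[OF b] by (elim bexE exE conjE) (rule that; assumption)
  note va = all[rule_format, THEN conjunct1] and g\<gamma> = all[rule_format, THEN conjunct2, THEN conjunct1]
    and GV = all[rule_format, THEN conjunct2, THEN conjunct2]
  have d0: "real d > 0" using dim_pos by simp
  have a_lt1: "a < 1" using va[of 0] form_le_1[OF v_in[of 0] c] a1 by (auto simp: less_le)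
  define R where "R = arccos a"
  have R: "cos R = a" "R \<ge> 0" "R < pi / 2"
    using a a_lt1 arccos_less_arccos[of 0 a] by (auto simp: R_def intro: arccos_lbound)
  then have Rpi: "R \<le> pi" using pi_ge_zero by linarith
  have sR: "sin R = sqrt (1 * (1 - a\<^sup>2))" unfolding R(1)[symmetric] using R Rpi sin_ge_zero[of R]
    unfolding mult_1 sin_squared_eq[symmetric] by simp
  have tR: "tan R \<ge> 0" using sR a R(1) a1 by (simp add: tan_def)
  define r where "r = arctan (tan R / d)"
  have tr: "tan r = tan R / d" by (simp add: r_def tan_arctan)
  have r: "r \<ge> 0" "r < pi / 2" using tR d0 arctan_ubound by (auto simp: r_def)
  then have rpi: "r \<le> pi" using pi_ge_zero by linarith
  have "R \<in> out_radii"
    using ball_contains_T[OF c, of R] R va form_sym[of 1 d c] c by auto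
  moreover have "cball_in M (sdist d) c r \<subseteq> T"
  proof
    fix z assume "z \<in> cball_in M (sdist d) c r"
    then have z: "z \<in> M" and zr: "sdist d c z \<le> r" by (auto simp: cball_in_def)
    define \<delta> where "\<delta> = sdist d c z"
    have \<delta>: "\<delta> \<ge> 0" "cos \<delta> = B c z" "\<delta> \<le> r" "\<delta> \<le> pi" using c z zr by (auto simp: \<delta>_def sdist_nonneg cos_sdist sdist_le_pi)
    have co: "cos \<delta> > 0" using \<delta> r by (intro cos_gt_zero_pi) auto
    have "B (g j) z \<ge> 0" if j: "j \<le> d" for j
    proof -
      let ?G = "sqrt (pf c (g j) (g j))"
      have zc: "B z c = cos \<delta>" using \<delta>(2) form_sym[of 1 d z c] by simp
      then have "pf c z z = (sin \<delta>)\<^sup>2" using pf_self[OF z, of c] by (simp add: sin_squared_eq)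
      then have 1: "sqrt (pf c z z) = sin \<delta>" using \<delta>(1,4) sin_ge_zero by simp
      have 2: "B (g j) z = pf c (g j) z + \<gamma> * cos \<delta>"
        using zc by (simp add: pf_def g\<gamma>[OF j])
      have "?G * sin R = d * \<gamma> * cos R" using GV[OF j] sR R(1) by simp
      then have "?G * tan R = d * \<gamma>" using a R(1) by (simp add: tan_def field_simps)
      then have 3: "?G * tan r = \<gamma>" unfolding tr using d0 by (simp add: field_simps)
      have "tan \<delta> \<le> tan r" using \<delta> r by (intro tan_mono_le) auto
      then have "?G * tan \<delta> \<le> ?G * tan r" using pf_nonneg[OF c] by (intro mult_left_mono) auto
      then have "?G * tan \<delta> \<le> \<gamma>" using 3 by simp
      then have "?G * sin \<delta> \<le> \<gamma> * cos \<delta>" using co by (simp add: tan_def field_simps)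
      then show ?thesis using pf_ge_sqrt[OF c, of "g j" z] 1 2 by simp
    qed
    then show "z \<in> T" using z by (simp add: T_def)
  qed
  then have "r \<in> in_radii" using r c by auto
  moreover have "tan R = d * tan r" using tr d0 by simp
  ultimately show ?thesis using R(3) by blast
qed

lemma radii_theorem:
  "tan (Inf out_radii) \<ge> d * tan (Sup in_radii)"
  "tan (Inf out_radii) = d * tan (Sup in_radii) \<longleftrightarrow> (\<exists>b. \<forall>i\<le>d. \<forall>j\<le>d. i \<noteq> j \<longrightarrow> B (v i) (v j) = b)"
proof -
  obtain c where c: "c \<in> M" "Sup in_radii \<ge> 0" "Sup in_radii < pi / 2"
    "\<And>j. j \<le> d \<Longrightarrow> sin (Sup in_radii) * sqrt (pf c (g j) (g j)) \<le> cos (Sup in_radii) * B (g j) c"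
    using inradius_attained by blast
  obtain p where p: "p \<in> M" "Inf out_radii \<ge> 0" "Inf out_radii < pi / 2"
    "\<And>j. j \<le> d \<Longrightarrow> cos (Inf out_radii) \<le> B p (v j)"
    using circumradius_attained by blast
  note main = tan_inequality[OF c(1) p(1) c(2,3) p(2,3) c(4) p(4)]
  show le: "tan (Inf out_radii) \<ge> d * tan (Sup in_radii)" by (rule main(1))
  show "tan (Inf out_radii) = d * tan (Sup in_radii) \<longleftrightarrow> (\<exists>b. \<forall>i\<le>d. \<forall>j\<le>d. i \<noteq> j \<longrightarrow> B (v i) (v j) = b)"
  proof
    assume "tan (Inf out_radii) = d * tan (Sup in_radii)"
    from main(2)[OF _ _ this[symmetric]] show "\<exists>b. \<forall>i\<le>d. \<forall>j\<le>d. i \<noteq> j \<longrightarrow> B (v i) (v j) = b" by blast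
  next
    assume "\<exists>b. \<forall>i\<le>d. \<forall>j\<le>d. i \<noteq> j \<longrightarrow> B (v i) (v j) = b"
    then obtain b where "\<forall>i\<le>d. \<forall>j\<le>d. i \<noteq> j \<longrightarrow> B (v i) (v j) = b" ..
    from regular_radii[OF this] obtain r R where r: "r \<in> in_radii" "R \<in> out_radii" "R < pi / 2" "tan R = d * tan r"
      by (elim bexE conjE) (rule that; assumption)
    \<comment> \<open>Unlike \<open>tanh\<close>, \<open>tan\<close> is increasing only up to
      \<open>pi / 2\<close>, which is why the bounds on the radii are carried along.\<close>
    have "tan (Inf out_radii) \<le> tan R"
      using cInf_lower[OF r(2) bdd_below_out_radii] p(2) r(3) by (intro tan_mono_le) auto
    also have "\<dots> = d * tan r" by (rule r(4))
    also have "\<dots> \<le> d * tan (Sup in_radii)"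
    proof (rule mult_left_mono)
      have "0 \<le> r" using r(1) unfolding mem_Collect_eq by (rule conjunct1)
      then have "- (pi / 2) < r" using pi_gt_zero by linarith
      then show "tan r \<le> tan (Sup in_radii)"
        using cSup_upper[OF r(1) bdd_above_in_radii] c(3) by (rule tan_mono_le)
    qed simp
    finally show "tan (Inf out_radii) = d * tan (Sup in_radii)" using le by simp
  qed
qed

lemma regular_iff:
  "regular_simplex (sdist d) d v \<longleftrightarrow> (\<exists>b. \<forall>i\<le>d. \<forall>j\<le>d. i \<noteq> j \<longrightarrow> B (v i) (v j) = b)"
proof
  assume reg: "regular_simplex (sdist d) d v"
  have "B (v i) (v j) = cos (sdist d (v 0) (v 1))" if "i \<le> d" "j \<le> d" "i \<noteq> j" for i j
  proof -
    have "sdist d (v i) (v j) = sdist d (v 0) (v 1)"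
      using reg that dim_pos unfolding regular_simplex_def by (metis le0 zero_neq_one)
    then show ?thesis using cos_sdist[OF v_in v_in] that by metis
  qed
  then show "\<exists>b. \<forall>i\<le>d. \<forall>j\<le>d. i \<noteq> j \<longrightarrow> B (v i) (v j) = b" by blast
next
  assume "\<exists>b. \<forall>i\<le>d. \<forall>j\<le>d. i \<noteq> j \<longrightarrow> B (v i) (v j) = b"
  then show "regular_simplex (sdist d) d v"
    unfolding regular_simplex_def sdist_def eucl_eq_form by metis
qed

end

section \<open>Return from the cone to the metric hull\<close>

lemma hyp_radii:
  assumes d: "d \<ge> 1" and v: "hyp_simplex_vertices d v" and S: "S = ghull (hyp d) (hdist d) (v ` {..d})"
  shows "tanh (circumradius (hyp d) (hdist d) S) \<ge> real d * tanh (inradius (hyp d) (hdist d) S)"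
    and "tanh (circumradius (hyp d) (hdist d) S) = real d * tanh (inradius (hyp d) (hdist d) S)
      \<longleftrightarrow> regular_simplex (hdist d) d v"
proof -
  interpret F: space_form "-1" d by unfold_locales simp
  obtain g where "simplex (-1) d v g"
    using F.exists_dual[of v] v d by (auto simp: hyp_simplex_vertices_def hyp_eq_space_pts)
  then interpret simplex "-1" d v g .
  interpret hyp_simplex d v g by unfold_locales
  have ST: "S = T" using ghull_eq[OF geodesic_hdist] S by (simp add: hyp_eq_space_pts)
  show "tanh (circumradius (hyp d) (hdist d) S) \<ge> real d * tanh (inradius (hyp d) (hdist d) S)"
    "tanh (circumradius (hyp d) (hdist d) S) = real d * tanh (inradius (hyp d) (hdist d) S)
      \<longleftrightarrow> regular_simplex (hdist d) d v"
    using radii_theorem unfolding regular_iff ST circumradius_def inradius_def hyp_eq_space_pts .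
qed

lemma sph_radii:
  assumes d: "d \<ge> 1" and v: "sph_simplex_vertices d v" and S: "S = ghull (sph d) (sdist d) (v ` {..d})"
  shows "tan (circumradius (sph d) (sdist d) S) \<ge> real d * tan (inradius (sph d) (sdist d) S)"
    and "tan (circumradius (sph d) (sdist d) S) = real d * tan (inradius (sph d) (sdist d) S)
      \<longleftrightarrow> regular_simplex (sdist d) d v"
proof -
  interpret F: space_form 1 d by unfold_locales simp
  obtain g where "simplex 1 d v g"
    using F.exists_dual[of v] v d by (auto simp: sph_simplex_vertices_def sph_eq_space_pts)
  then interpret simplex 1 d v g .
  interpret sph_simplex d v g by unfold_locales
  have ST: "S = T" using ghull_eq[OF geodesic_sdist] S by (simp add: sph_eq_space_pts)
  show "tan (circumradius (sph d) (sdist d) S) \<ge> real d * tan (inradius (sph d) (sdist d) S)"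
    "tan (circumradius (sph d) (sdist d) S) = real d * tan (inradius (sph d) (sdist d) S)
      \<longleftrightarrow> regular_simplex (sdist d) d v"
    using radii_theorem unfolding regular_iff ST circumradius_def inradius_def sph_eq_space_pts .
qed

theorem mainTheorem10:
  shows "(\<forall>d::nat. \<forall>v S. d \<ge> 2 \<longrightarrow> hyp_simplex_vertices d v \<longrightarrow>
            S = ghull (hyp d) (hdist d) (v ` {..d}) \<longrightarrow>
            tanh (circumradius (hyp d) (hdist d) S) \<ge> real d * tanh (inradius (hyp d) (hdist d) S) \<and>
            (tanh (circumradius (hyp d) (hdist d) S) = real d * tanh (inradius (hyp d) (hdist d) S)
               \<longleftrightarrow> regular_simplex (hdist d) d v))
       \<and> (\<forall>d::nat. \<forall>v S. d \<in> {2, 3} \<longrightarrow> sph_simplex_vertices d v \<longrightarrow>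
            S = ghull (sph d) (sdist d) (v ` {..d}) \<longrightarrow>
            tan (circumradius (sph d) (sdist d) S) \<ge> real d * tan (inradius (sph d) (sdist d) S) \<and>
            (tan (circumradius (sph d) (sdist d) S) = real d * tan (inradius (sph d) (sdist d) S)
               \<longleftrightarrow> regular_simplex (sdist d) d v))"
proof (intro conjI allI impI)
  fix d :: nat and v S
  assume "d \<ge> 2" and v: "hyp_simplex_vertices d v" "S = ghull (hyp d) (hdist d) (v ` {..d})"
  then have "d \<ge> 1" by simp
  from hyp_radii[OF this v]
  show "tanh (circumradius (hyp d) (hdist d) S) \<ge> real d * tanh (inradius (hyp d) (hdist d) S)"
    "tanh (circumradius (hyp d) (hdist d) S) = real d * tanh (inradius (hyp d) (hdist d) S)
      \<longleftrightarrow> regular_simplex (hdist d) d v" .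
next
  fix d :: nat and v S
  assume "d \<in> {2, 3}" and v: "sph_simplex_vertices d v" "S = ghull (sph d) (sdist d) (v ` {..d})"
  then have "d \<ge> 1" by auto
  from sph_radii[OF this v]
  show "tan (circumradius (sph d) (sdist d) S) \<ge> real d * tan (inradius (sph d) (sdist d) S)"
    "tan (circumradius (sph d) (sdist d) S) = real d * tan (inradius (sph d) (sdist d) S)
      \<longleftrightarrow> regular_simplex (sdist d) d v" .
qed

end
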